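(* Let $d>1$ be an integer, $p\in(1,\infty)$ and $s\in(0,1)$. Let $D\subset\mathbb{R}^d$ be an open set (not necessarily bounded) for which there is a constant $C_H$ such that for every $u\in (C_c^1(D))^d$, $$\int_D\frac{|u(x)|^p}{d(x,D^c)^{sp}}\,dx\leq C_H\,|u|_{\mathcal{X}^{s,p}(D)}^p.$$ Then there exists a constant $C\geq 1$ such that for every $u\in (C_c^1(D))^d$, $$C|u|_{\mathcal{X}^{s,p}(D)}\geq |u|_{W^{s,p}(D)}.$$
   Context: $(C_c^1(D))^d$ is the space of compactly supported $C^1$ vector fields $u\colon D\to\mathbb{R}^d$. $D^c=\mathbb{R}^d\setminus D$ and $d(x,D^c)$ is the Euclidean distance from $x$ to $D^c$ (with $d(x,\emptyset)=+\infty$, so that the left-hand integral is $0$ if $D=\mathbb{R}^d$). For a measurable vector field $u\colon D\to\mathbb{R}^d$ the seminorms are $$|u|_{W^{s,p}(D)}^p=\int_D\int_D\frac{|u(x)-u(y)|^p}{|x-y|^{d+sp}}\,dx\,dy,\qquad |u|_{\mathcal{X}^{s,p}(D)}^p=\int_D\int_D\frac{\big|(u(x)-u(y))\cdot\frac{x-y}{|x-y|}\big|^p}{|x-y|^{d+sp}}\,dx\,dy,$$ where $\cdot$ is the Euclidean scalar product. *)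

theory Defs
  imports "HOL-Analysis.Analysis"
begin

text \<open>
  A vector field on an open set \<open>D\<close> is represented by a total function; its values outside \<open>D\<close>
  are arbitrary and are never used below.
\<close>

definition Cc1 :: "'a::euclidean_space set \<Rightarrow> ('a \<Rightarrow> 'a) set" where
  "Cc1 D = {u.
     (\<exists>u' :: 'a \<Rightarrow> 'a \<Rightarrow>\<^sub>L 'a.
        (\<forall>x\<in>D. (u has_derivative blinfun_apply (u' x)) (at x)) \<and> continuous_on D u') \<and>
     compact (closure {x\<in>D. u x \<noteq> 0}) \<and> closure {x\<in>D. u x \<noteq> 0} \<subseteq> D}"

text \<open>
  The \<open>p\<close>-th powers of the seminorms take values in \<open>[0, \<infinity>]\<close>. The integrands are \<open>0\<close> on the
  diagonal \<open>x = y\<close>, a null set, because \<open>a / 0 = 0\<close>.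
\<close>

definition W_energy :: "real \<Rightarrow> real \<Rightarrow> 'a::euclidean_space set \<Rightarrow> ('a \<Rightarrow> 'a) \<Rightarrow> ennreal" where
  "W_energy s p D u =
     (\<integral>\<^sup>+y\<in>D. (\<integral>\<^sup>+x\<in>D.
        ennreal (norm (u x - u y) powr p / norm (x - y) powr (real DIM('a) + s * p))
      \<partial>lborel) \<partial>lborel)"

definition X_energy :: "real \<Rightarrow> real \<Rightarrow> 'a::euclidean_space set \<Rightarrow> ('a \<Rightarrow> 'a) \<Rightarrow> ennreal" where
  "X_energy s p D u =
     (\<integral>\<^sup>+y\<in>D. (\<integral>\<^sup>+x\<in>D.
        ennreal (\<bar>(u x - u y) \<bullet> ((x - y) /\<^sub>R norm (x - y))\<bar> powr p
                 / norm (x - y) powr (real DIM('a) + s * p))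
      \<partial>lborel) \<partial>lborel)"

definition ennroot :: "real \<Rightarrow> ennreal \<Rightarrow> ennreal" where
  "ennroot p a = (if a = top then top else ennreal (enn2real a powr (1 / p)))"

definition W_seminorm :: "real \<Rightarrow> real \<Rightarrow> 'a::euclidean_space set \<Rightarrow> ('a \<Rightarrow> 'a) \<Rightarrow> ennreal" where
  "W_seminorm s p D u = ennroot p (W_energy s p D u)"

definition X_seminorm :: "real \<Rightarrow> real \<Rightarrow> 'a::euclidean_space set \<Rightarrow> ('a \<Rightarrow> 'a) \<Rightarrow> ennreal" where
  "X_seminorm s p D u = ennroot p (X_energy s p D u)"

text \<open>
  For \<open>D = UNIV\<close> the distance to the complement is \<open>+\<infinity>\<close> and the integral is \<open>0\<close>, whereas the
  library sets \<open>infdist x {} = 0\<close>; hence the case distinction.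
\<close>

definition Hardy_integral ::
    "real \<Rightarrow> real \<Rightarrow> 'a::euclidean_space set \<Rightarrow> ('a \<Rightarrow> 'a) \<Rightarrow> ennreal" where
  "Hardy_integral s p D u =
     (if D = UNIV then 0
      else (\<integral>\<^sup>+x\<in>D. ennreal (norm (u x) powr p / infdist x (- D) powr (s * p)) \<partial>lborel))"

end

theory Submission
  imports Defs
begin

text \<open>
  Extending a field \<open>u\<close> by zero enlarges its \<open>X\<close>-energy by at most a multiple of the Hardy integral,
  so it is enough to prove Korn's inequality on the whole space. There, two facts are combined.

  First, second differences are controlled by projected differences: for
  \<open>E(a,b) = (u(a) - u(b)) \<bullet> (a - b)\<close> and \<open>q = x + h + w\<close>,
  \<open>(u(x + 2h) - 2u(x + h) + u(x)) \<bullet> w = E(x + 2h,x)/2 - E(q,x) - E(q,x + 2h) + 2E(q,x + h)\<close>.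
  Averaging over \<open>\<bar>w\<bar> < \<bar>h\<bar>\<close> recovers the whole second difference on the left, and on the right only
  translations are needed to recover the \<open>X\<close>-energy.

  Second, since \<open>2(u(x + h) - u(x))\<close> is \<open>u(x + 2h) - u(x)\<close> minus the second difference, the \<open>W\<close>-energy is at
  most \<open>q < 1\<close> times itself plus a multiple of the energy of second differences; the factor is
  smaller than 1 because \<open>s < 1\<close>. Restricting to \<open>\<bar>h\<bar> \<ge> r\<close> makes the \<open>W\<close>-energy finite, so that it can be
  absorbed, and then \<open>r\<close> tends to 0.
\<close>

section \<open>Translations, dilations and elementary power inequalities\<close>

lemma nn_integral_lborel_shift:
  fixes f :: "'a::euclidean_space \<Rightarrow> ennreal"
  assumes [measurable]: "f \<in> borel_measurable borel"
  shows "(\<integral>\<^sup>+x. f (x + a) \<partial>lborel) = (\<integral>\<^sup>+x. f x \<partial>lborel)"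
proof -
  have "(\<integral>\<^sup>+x. f x \<partial>lborel) = (\<integral>\<^sup>+x. f x \<partial>distr lborel borel ((+) a))"
    by (simp add: lborel_distr_plus)
  also have "\<dots> = (\<integral>\<^sup>+x. f (x + a) \<partial>lborel)"
    by (subst nn_integral_distr) (auto simp: add.commute)
  finally show ?thesis by simp
qed

lemma nn_integral_lborel_scale:
  fixes f :: "'a::euclidean_space \<Rightarrow> ennreal"
  assumes [measurable]: "f \<in> borel_measurable borel" and "0 < c"
  shows "(\<integral>\<^sup>+x. f (c *\<^sub>R x) \<partial>lborel) = ennreal (c powr - real DIM('a)) * (\<integral>\<^sup>+x. f x \<partial>lborel)"
proof -
  have "(\<integral>\<^sup>+x. f x \<partial>lborel) = ennreal (c ^ DIM('a)) * (\<integral>\<^sup>+x. f (c *\<^sub>R x) \<partial>lborel)"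
    using \<open>0 < c\<close>
    by (subst lborel_affine[of c 0]) (auto simp: nn_integral_density nn_integral_distr nn_integral_cmult)
  moreover have "ennreal (c powr - real DIM('a)) * ennreal (c ^ DIM('a)) = 1"
    using \<open>0 < c\<close> by (simp add: ennreal_mult'[symmetric] powr_minus powr_realpow)
  ultimately show ?thesis by (simp add: mult.assoc[symmetric])
qed

text \<open>Either b is at most e times a, and then a + b is at most (1 + e) a, or a + b is at most
  (1 + 1/e) b. The free parameter e allows the coefficient of a^p to be taken close to 1, at the
  price of a large coefficient of b^p; the absorption argument relies on this.\<close>

lemma add_powr_le:
  fixes a b e p :: real
  assumes "0 \<le> a" "0 \<le> b" "0 < e" "0 \<le> p"
  shows "(a + b) powr p \<le> (1 + e) powr p * a powr p + (1 + 1 / e) powr p * b powr p"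
proof (cases "b \<le> e * a")
  case True
  then have "a + b \<le> (1 + e) * a" by (simp add: algebra_simps)
  then have "(a + b) powr p \<le> ((1 + e) * a) powr p" using assms by (intro powr_mono2) auto
  also have "\<dots> = (1 + e) powr p * a powr p" using assms by (simp add: powr_mult)
  finally show ?thesis by (simp add: add_increasing2)
next
  case False
  then have "a + b \<le> (1 + 1 / e) * b" using assms by (simp add: field_simps)
  then have "(a + b) powr p \<le> ((1 + 1 / e) * b) powr p" using assms by (intro powr_mono2) auto
  also have "\<dots> = (1 + 1 / e) powr p * b powr p" using assms by (simp add: powr_mult)
  finally show ?thesis by (simp add: add_increasing)
qed

lemma sum4_powr_le:
  fixes a b c e p :: real
  assumes "0 \<le> p"
  shows "\<bar>a + b + c + e\<bar> powr p \<le> 4 powr p * (\<bar>a\<bar> powr p + \<bar>b\<bar> powr p + \<bar>c\<bar> powr p + \<bar>e\<bar> powr p)"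
proof -
  have two: "(x + y) powr p \<le> 2 powr p * (x powr p + y powr p)" if "0 \<le> x" "0 \<le> y" for x y :: real
    using add_powr_le[of x y 1 p] that assms by (simp add: distrib_left)
  have "\<bar>a + b + c + e\<bar> \<le> (\<bar>a\<bar> + \<bar>b\<bar>) + (\<bar>c\<bar> + \<bar>e\<bar>)"
    by linarith
  then have "\<bar>a + b + c + e\<bar> powr p \<le> ((\<bar>a\<bar> + \<bar>b\<bar>) + (\<bar>c\<bar> + \<bar>e\<bar>)) powr p"
    by (rule powr_mono2[OF assms abs_ge_zero])
  also have "\<dots> \<le> 2 powr p * ((\<bar>a\<bar> + \<bar>b\<bar>) powr p + (\<bar>c\<bar> + \<bar>e\<bar>) powr p)"
    by (rule two) simp_all
  also have "\<dots> \<le> 2 powr p * (2 powr p * (\<bar>a\<bar> powr p + \<bar>b\<bar> powr p) + 2 powr p * (\<bar>c\<bar> powr p + \<bar>e\<bar> powr p))"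
    by (intro mult_left_mono add_mono two abs_ge_zero powr_ge_zero)
  also have "\<dots> = (2 powr p * 2 powr p) * (\<bar>a\<bar> powr p + \<bar>b\<bar> powr p + \<bar>c\<bar> powr p + \<bar>e\<bar> powr p)"
    by (simp only: distrib_left mult.assoc add.assoc)
  also have "2 powr p * 2 powr p = (4::real) powr p"
    by (simp flip: powr_mult)
  finally show ?thesis .
qed

section \<open>Tail integrals of negative powers and averages over balls\<close>

text \<open>Cut the region into dyadic annuli of inner radius 2^k r. Each contributes at most a
  constant times (2^k r)^(d - a), and these sum as a geometric series with ratio 2^(d - a) < 1. The
  bound serves three times: for the kernel of the averages over w, for the finiteness of the
  truncated \<open>W\<close>-energy, and for the integral over the complement of
  \<open>D\<close>.\<close>

lemma tail_integral:
  assumes "real DIM('a) < a"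
  shows "\<exists>C\<ge>0. \<forall>r>0. (\<integral>\<^sup>+h. ennreal (norm h powr - a) * indicator {h. r \<le> norm h} h \<partial>(lborel :: 'a::euclidean_space measure))
           \<le> ennreal (C * r powr (real DIM('a) - a))"
proof -
  define d where "d = DIM('a)"
  define V where "V = unit_ball_vol (real d)"
  define q where "q = 2 powr (real d - a)"
  have "V > 0" unfolding V_def by simp
  have q: "0 < q" "q < 1" unfolding q_def d_def using assms by (auto simp: powr_less_one)
  have a: "a > 0" using assms by (meson le_less_trans of_nat_0_le_iff)
  have bound: "(\<integral>\<^sup>+h. ennreal (norm h powr - a) * indicator {h. r \<le> norm h} h \<partial>(lborel :: 'a measure))
      \<le> ennreal (V * 2 ^ d / (1 - q) * r powr (real d - a))" if "r > 0" for r
  proof -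
    \<comment> \<open>\<open>G k\<close> dominates the integrand on the k-th annulus. Using the
      whole ball of the outer radius in place of the annulus only affects the constant, by the
      factor 2^d.\<close>
    define G where "G = (\<lambda>k (h::'a). ennreal ((2 ^ k * r) powr - a) * indicator (ball 0 (2 ^ Suc k * r)) h)"
    have "ennreal (norm h powr - a) * indicator {h. r \<le> norm h} h \<le> (\<Sum>k. G k h)" for h :: 'a
    proof (cases "r \<le> norm h")
      case True
      \<comment> \<open>The minimal n is positive because r is at most the norm of h; its
        predecessor k is the index of the annulus that contains h.\<close>
      define n where "n = (LEAST n. norm h < 2 ^ n * r)"
      have ex: "\<exists>n. norm h < 2 ^ n * r"
        using real_arch_pow[of 2 "norm h / r"] \<open>r > 0\<close> by (auto simp: field_simps)
      then have n: "norm h < 2 ^ n * r" unfolding n_def by (rule LeastI_ex)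
      have "n \<noteq> 0" using n True by (intro notI) simp
      then obtain k where k: "n = Suc k" using not0_implies_Suc by blast
      have "\<not> norm h < 2 ^ k * r" using not_less_Least[of k "\<lambda>n. norm h < 2 ^ n * r"] k n_def by simp
      then have "norm h powr - a \<le> (2 ^ k * r) powr - a"
        using a \<open>r > 0\<close> by (intro powr_mono2') auto
      then have "ennreal (norm h powr - a) * indicator {h. r \<le> norm h} h \<le> G k h"
        using n k True by (simp add: G_def)
      also have "\<dots> \<le> (\<Sum>k. G k h)" using sum_le_suminf[of "\<lambda>k. G k h" "{k}"] by simp
      finally show ?thesis .
    qed simp
    then have "(\<integral>\<^sup>+h. ennreal (norm h powr - a) * indicator {h. r \<le> norm h} h \<partial>(lborel :: 'a measure))
        \<le> (\<integral>\<^sup>+h. (\<Sum>k. G k h) \<partial>lborel)" by (intro nn_integral_mono)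
    also have "\<dots> = (\<Sum>k. \<integral>\<^sup>+h. G k h \<partial>lborel)"
    proof (rule nn_integral_suminf)
      fix k show "G k \<in> borel_measurable lborel"
        unfolding G_def by (intro borel_measurable_times_ennreal borel_measurable_const borel_measurable_indicator) simp
    qed
    also have "\<dots> = (\<Sum>k. ennreal (V * 2 ^ d * r powr (real d - a) * q ^ k))"
    proof (intro arg_cong[where f=suminf] ext)
      fix k
      have "(\<integral>\<^sup>+h. G k h \<partial>lborel) = ennreal ((2 ^ k * r) powr - a) * ennreal (V * (2 ^ Suc k * r) ^ d)"
        unfolding G_def using \<open>r > 0\<close>
        by (subst nn_integral_cmult_indicator) (auto simp: emeasure_ball V_def d_def)
      also have "\<dots> = ennreal ((2 ^ k * r) powr - a * (V * (2 ^ Suc k * r) ^ d))"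
        by (simp add: ennreal_mult')
      also have "(2 ^ k * r) powr - a * (V * (2 ^ Suc k * r) ^ d) = V * 2 ^ d * ((2 ^ k * r) powr - a * (2 ^ k * r) powr real d)"
        using \<open>r > 0\<close> by (simp add: powr_realpow power_mult_distrib)
      also have "(2 ^ k * r) powr - a * (2 ^ k * r) powr real d = (2 ^ k * r) powr (real d - a)"
        by (simp add: powr_add[symmetric])
      also have "\<dots> = r powr (real d - a) * q ^ k"
      proof -
        have "(2 ^ k) powr (real d - a) = q ^ k"
          by (simp add: q_def powr_realpow[symmetric] powr_powr mult.commute)
        then show ?thesis using \<open>r > 0\<close> by (simp add: powr_mult)
      qed
      finally show "(\<integral>\<^sup>+h. G k h \<partial>lborel) = ennreal (V * 2 ^ d * r powr (real d - a) * q ^ k)"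
        by (simp add: mult.assoc)
    qed
    also have "\<dots> = ennreal (V * 2 ^ d * r powr (real d - a) * (1 / (1 - q)))"
      using q \<open>V > 0\<close> by (intro suminf_ennreal_eq sums_mult geometric_sums) auto
    finally show ?thesis by (simp add: mult_ac)
  qed
  show ?thesis
  proof (intro exI conjI allI impI)
    show "V * 2 ^ d / (1 - q) \<ge> 0" using q \<open>V > 0\<close> by simp
  qed (use bound in \<open>simp add: d_def\<close>)
qed

text \<open>Take the point \<open>m\<close> of length |h|/2 in the direction of v. The ball of
  radius |h|/4 around it stays inside the ball of radius |h|, and on it the product of v and w is at
  least |v||h|/2 - |v||h|/4 = |v||h|/4. Integrating over this small ball alone gives the
  bound.\<close>

lemma average_lower_bound:
  fixes p :: real
  assumes "0 \<le> p"
  shows "\<exists>c>0. \<forall>(h::'a::euclidean_space) (v::'a). ennreal (c * norm v powr p * norm h powr (real DIM('a) + p))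
     \<le> (\<integral>\<^sup>+w. (if norm w < norm h then ennreal (\<bar>v \<bullet> w\<bar> powr p) else 0) \<partial>lborel)"
proof -
  define d where "d = DIM('a)"
  define V where "V = unit_ball_vol (real d)"
  define c where "c = V * (1/4) ^ d * (1/4) powr p"
  have "V > 0" unfolding V_def by simp
  then have c: "c > 0" unfolding c_def by simp
  have bound: "ennreal (c * norm v powr p * norm h powr (real d + p))
     \<le> (\<integral>\<^sup>+w. (if norm w < norm h then ennreal (\<bar>v \<bullet> w\<bar> powr p) else 0) \<partial>lborel)" for h v :: 'a
  \<comment> \<open>In the degenerate cases the left side is 0, because \<open>0 powr x = 0\<close>
    for every x.\<close>
  proof (cases "v = 0 \<or> h = 0")
    case False
    define m where "m = (norm h / (2 * norm v)) *\<^sub>R v"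
    have in_ball: "norm w < norm h" "norm v * norm h / 4 \<le> v \<bullet> w" if "w \<in> ball m (norm h / 4)" for w
    proof -
      have w: "norm (w - m) < norm h / 4" using that by (simp add: dist_norm norm_minus_commute)
      have "norm m = norm h / 2" using False by (simp add: m_def)
      then show "norm w < norm h" using w norm_triangle_ineq[of m "w - m"] False
          zero_less_norm_iff[of h] unfolding add_diff_cancel_left' diff_add_cancel add_diff_eq by linarith
      have "v \<bullet> m = norm v * norm h / 2"
        using False by (simp add: m_def dot_square_norm power2_eq_square)
      moreover have "\<bar>v \<bullet> (w - m)\<bar> \<le> norm v * (norm h / 4)"
        by (rule order_trans[OF Cauchy_Schwarz_ineq2 mult_left_mono[OF less_imp_le[OF w] norm_ge_zero]])
      moreover have "v \<bullet> w = v \<bullet> m + v \<bullet> (w - m)" by (simp add: inner_diff_right)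
      ultimately show "norm v * norm h / 4 \<le> v \<bullet> w" by linarith
    qed
    have "c * norm v powr p * norm h powr (real d + p) = (norm v * norm h / 4) powr p * (V * (norm h / 4) ^ d)"
      using False by (simp add: c_def powr_add powr_realpow powr_mult powr_divide power_divide) (simp only: mult_ac)
    also have "ennreal \<dots> = (\<integral>\<^sup>+w. ennreal ((norm v * norm h / 4) powr p) * indicator (ball m (norm h / 4)) w \<partial>lborel)"
      by (subst nn_integral_cmult_indicator) (auto simp: emeasure_ball V_def d_def ennreal_mult')
    also have "\<dots> \<le> (\<integral>\<^sup>+w. (if norm w < norm h then ennreal (\<bar>v \<bullet> w\<bar> powr p) else 0) \<partial>lborel)"
    proof (intro nn_integral_mono)
      fix w
      show "ennreal ((norm v * norm h / 4) powr p) * indicator (ball m (norm h / 4)) w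
        \<le> (if norm w < norm h then ennreal (\<bar>v \<bullet> w\<bar> powr p) else 0)"
      proof (cases "w \<in> ball m (norm h / 4)")
        case True
        have "(norm v * norm h / 4) powr p \<le> \<bar>v \<bullet> w\<bar> powr p"
          using in_ball(2)[OF True] assms by (intro powr_mono2) auto
        then show ?thesis using in_ball(1)[OF True] True by simp
      qed simp
    qed
    finally show ?thesis .
  qed auto
  show ?thesis by (intro exI[of _ c] conjI allI c bound[unfolded d_def])
qed

section \<open>Energies on the whole space as integrals over the displacement\<close>

definition increment :: "real \<Rightarrow> ('a::euclidean_space \<Rightarrow> 'a) \<Rightarrow> 'a \<Rightarrow> ennreal" where
  "increment p u h = (\<integral>\<^sup>+x. ennreal (norm (u (x + h) - u x) powr p) \<partial>lborel)"

text \<open>The displacement z is not normalised, so that the integrand is the power of a quantity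
  linear in u and bilinear in the difference and z, as the identity for second differences needs.
  The missing factor |z|^(-p) reappears in the weight of \<open>X_energy_UNIV\<close>.\<close>

definition strain :: "real \<Rightarrow> ('a::euclidean_space \<Rightarrow> 'a) \<Rightarrow> 'a \<Rightarrow> ennreal" where
  "strain p u z = (\<integral>\<^sup>+x. ennreal (\<bar>(u (x + z) - u x) \<bullet> z\<bar> powr p) \<partial>lborel)"

definition second_diff :: "('a::euclidean_space \<Rightarrow> 'a) \<Rightarrow> 'a \<Rightarrow> 'a \<Rightarrow> 'a" where
  "second_diff u h x = u (x + 2 *\<^sub>R h) - 2 *\<^sub>R u (x + h) + u x"

definition second_increment :: "real \<Rightarrow> ('a::euclidean_space \<Rightarrow> 'a) \<Rightarrow> 'a \<Rightarrow> ennreal" where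
  "second_increment p u h = (\<integral>\<^sup>+x. ennreal (norm (second_diff u h x) powr p) \<partial>lborel)"

lemma measurable_increment [measurable]:
  assumes [measurable]: "u \<in> borel_measurable borel"
  shows "increment p u \<in> borel_measurable borel"
    and "strain p u \<in> borel_measurable borel"
    and "second_increment p u \<in> borel_measurable borel"
  unfolding increment_def[abs_def] strain_def[abs_def] second_increment_def[abs_def] second_diff_def
  by measurable

lemma strain_0 [simp]: "strain p u 0 = 0"
  by (simp add: strain_def)

lemma nn_integral_difference:
  fixes F :: "'a::euclidean_space \<Rightarrow> 'a \<Rightarrow> ennreal"
  assumes [measurable]: "case_prod F \<in> borel_measurable (borel \<Otimes>\<^sub>M borel)"
  shows "(\<integral>\<^sup>+y. \<integral>\<^sup>+x. F x y \<partial>lborel \<partial>lborel) = (\<integral>\<^sup>+z. \<integral>\<^sup>+y. F (y + z) y \<partial>lborel \<partial>lborel)"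
proof -
  have "(\<integral>\<^sup>+x. F x y \<partial>lborel) = (\<integral>\<^sup>+z. F (y + z) y \<partial>lborel)" for y
    using nn_integral_lborel_shift[of "\<lambda>x. F x y" y] by (simp add: add.commute)
  then have "(\<integral>\<^sup>+y. \<integral>\<^sup>+x. F x y \<partial>lborel \<partial>lborel) = (\<integral>\<^sup>+y. \<integral>\<^sup>+z. F (y + z) y \<partial>lborel \<partial>lborel)"
    by simp
  also have "\<dots> = (\<integral>\<^sup>+z. \<integral>\<^sup>+y. F (y + z) y \<partial>lborel \<partial>lborel)"
    by (rule lborel_pair.Fubini') measurable
  finally show ?thesis .
qed

lemma W_energy_UNIV:
  fixes u :: "'a::euclidean_space \<Rightarrow> 'a"
  assumes [measurable]: "u \<in> borel_measurable borel"
  shows "W_energy s p UNIV u =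
    (\<integral>\<^sup>+h. increment p u h * ennreal (norm h powr - (real DIM('a) + s * p)) \<partial>lborel)"
proof -
  have "W_energy s p UNIV u = (\<integral>\<^sup>+h. \<integral>\<^sup>+y.
      ennreal (norm (u (y + h) - u y) powr p / norm ((y + h) - y) powr (real DIM('a) + s * p)) \<partial>lborel \<partial>lborel)"
    unfolding W_energy_def by (simp, subst nn_integral_difference) auto
  also have "\<dots> = (\<integral>\<^sup>+h. increment p u h * ennreal (norm h powr - (real DIM('a) + s * p)) \<partial>lborel)"
    unfolding increment_def
    by (intro nn_integral_cong, subst nn_integral_multc[symmetric])
      (auto intro!: nn_integral_cong simp: ennreal_mult'[symmetric] powr_minus divide_inverse simp del: minus_add_distrib)
  finally show ?thesis .
qed

lemma X_energy_UNIV: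
  fixes u :: "'a::euclidean_space \<Rightarrow> 'a"
  assumes [measurable]: "u \<in> borel_measurable borel"
  shows "X_energy s p UNIV u =
    (\<integral>\<^sup>+h. strain p u h * ennreal (norm h powr - (real DIM('a) + s * p + p)) \<partial>lborel)"
proof -
  have "X_energy s p UNIV u = (\<integral>\<^sup>+h. \<integral>\<^sup>+y.
      ennreal (\<bar>(u (y + h) - u y) \<bullet> (((y + h) - y) /\<^sub>R norm ((y + h) - y))\<bar> powr p
        / norm ((y + h) - y) powr (real DIM('a) + s * p)) \<partial>lborel \<partial>lborel)"
    unfolding X_energy_def by (simp, subst nn_integral_difference) auto
  also have "\<dots> = (\<integral>\<^sup>+h. strain p u h * ennreal (norm h powr - (real DIM('a) + s * p + p)) \<partial>lborel)"
    unfolding strain_def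
  proof (intro nn_integral_cong, subst nn_integral_multc[symmetric])
    fix h :: 'a
    have "\<bar>v \<bullet> (h /\<^sub>R norm h)\<bar> powr p / norm h powr (real DIM('a) + s * p)
      = \<bar>v \<bullet> h\<bar> powr p * norm h powr - (real DIM('a) + s * p + p)" for v
      by (simp add: abs_mult powr_mult powr_minus powr_add[symmetric] divide_inverse inverse_powr,
          simp add: powr_minus[symmetric] powr_add[symmetric] inverse_powr algebra_simps,
          auto intro!: arg_cong2[where f="(powr)"])
    then show "(\<integral>\<^sup>+y. ennreal (\<bar>(u (y + h) - u y) \<bullet> (((y + h) - y) /\<^sub>R norm ((y + h) - y))\<bar> powr p
          / norm ((y + h) - y) powr (real DIM('a) + s * p)) \<partial>lborel)
      = (\<integral>\<^sup>+x. ennreal (\<bar>(u (x + h) - u x) \<bullet> h\<bar> powr p) * ennreal (norm h powr - (real DIM('a) + s * p + p)) \<partial>lborel)"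
      by (simp add: ennreal_mult'[symmetric] del: minus_add_distrib inner_scaleR_right)
  qed auto
  finally show ?thesis .
qed

text \<open>The homogeneity of the weight gives 2^b and the change of variables gives 2^(-d). For
  the weight of the \<open>W\<close>-energy, b = d + sp, the factor is 2^(sp), which for s < 1 is
  smaller than the 2^p gained by halving a difference.\<close>

lemma nn_integral_scale_powr:
  fixes f :: "'a::euclidean_space \<Rightarrow> ennreal"
  assumes [measurable]: "f \<in> borel_measurable borel"
  shows "(\<integral>\<^sup>+h. f (2 *\<^sub>R h) * ennreal (norm h powr - b) \<partial>lborel)
    = ennreal (2 powr (b - real DIM('a))) * (\<integral>\<^sup>+h. f h * ennreal (norm h powr - b) \<partial>lborel)"
proof -
  have "(\<integral>\<^sup>+h. f (2 *\<^sub>R h) * ennreal (norm h powr - b) \<partial>lborel)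
    = (\<integral>\<^sup>+h. ennreal (2 powr b) * (f (2 *\<^sub>R h) * ennreal (norm (2 *\<^sub>R h) powr - b)) \<partial>lborel)"
  proof (intro nn_integral_cong)
    fix h :: 'a
    have "ennreal (norm h powr - b) = ennreal (2 powr b) * ennreal (norm (2 *\<^sub>R h) powr - b)"
      by (subst ennreal_mult'[symmetric]) (simp_all add: powr_mult mult.assoc[symmetric] powr_add[symmetric])
    then show "f (2 *\<^sub>R h) * ennreal (norm h powr - b)
      = ennreal (2 powr b) * (f (2 *\<^sub>R h) * ennreal (norm (2 *\<^sub>R h) powr - b))"
      by (simp only: mult_ac)
  qed
  also have "\<dots> = ennreal (2 powr b) * (\<integral>\<^sup>+h. f (2 *\<^sub>R h) * ennreal (norm (2 *\<^sub>R h) powr - b) \<partial>lborel)"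
    by (subst nn_integral_cmult) auto
  also have "\<dots> = ennreal (2 powr b) * (ennreal (2 powr - real DIM('a)) * (\<integral>\<^sup>+h. f h * ennreal (norm h powr - b) \<partial>lborel))"
    by (subst nn_integral_lborel_scale[of "\<lambda>h. f h * ennreal (norm h powr - b)" 2]) auto
  also have "\<dots> = ennreal (2 powr (b - real DIM('a))) * (\<integral>\<^sup>+h. f h * ennreal (norm h powr - b) \<partial>lborel)"
    by (simp add: mult.assoc[symmetric] ennreal_mult'[symmetric] powr_add[symmetric])
  finally show ?thesis .
qed

section \<open>Second differences controlled by projected differences\<close>

text \<open>Seen from x, x + 2h and x + h, the auxiliary point q = x + h + w has displacements w +
  h, w - h and w. Since (w + h) + (w - h) = 2w, the value u(q) cancels; the first term corrects the
  remaining coefficients of u(x) and u(x + 2h) to w.\<close>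

lemma second_diff_inner:
  "second_diff u h x \<bullet> w =
     (u (x + 2 *\<^sub>R h) - u x) \<bullet> (2 *\<^sub>R h) / 2 - (u (x + (w + h)) - u x) \<bullet> (w + h)
     - (u (x + 2 *\<^sub>R h + (w - h)) - u (x + 2 *\<^sub>R h)) \<bullet> (w - h)
     + 2 * ((u (x + h + w) - u (x + h)) \<bullet> w)"
proof -
  have "x + 2 *\<^sub>R h + (w - h) = x + (w + h)" "x + h + w = x + (w + h)"
    by (simp_all add: scaleR_2)
  then show ?thesis
    by (simp add: second_diff_def algebra_simps) (simp add: field_simps)
qed

text \<open>Integration over x removes the shifts of the base points by 2h and h, so that only the
  displacements of the four terms matter. The constant is 4^p for a sum of four terms times 2^p,
  because all coefficients in \<open>second_diff_inner\<close> are at most 2 in absolute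
  value.\<close>

lemma nn_integral_second_diff_inner_le:
  fixes u :: "'a::euclidean_space \<Rightarrow> 'a"
  assumes [measurable]: "u \<in> borel_measurable borel" and "0 \<le> p"
  shows "(\<integral>\<^sup>+x. ennreal (\<bar>second_diff u h x \<bullet> w\<bar> powr p) \<partial>lborel)
    \<le> ennreal (8 powr p) * (strain p u (2 *\<^sub>R h) + strain p u (w + h) + strain p u (w - h) + strain p u w)"
proof -
  define E where "E = (\<lambda>z x. ennreal (\<bar>(u (x + z) - u x) \<bullet> z\<bar> powr p))"
  have [measurable]: "E z \<in> borel_measurable borel" for z unfolding E_def by measurable
  have "ennreal (\<bar>second_diff u h x \<bullet> w\<bar> powr p)
    \<le> ennreal (8 powr p) * (E (2 *\<^sub>R h) x + E (w + h) x + E (w - h) (x + 2 *\<^sub>R h) + E w (x + h))" for x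
  proof -
    define a b c e where "a = (u (x + 2 *\<^sub>R h) - u x) \<bullet> (2 *\<^sub>R h)"
      and "b = (u (x + (w + h)) - u x) \<bullet> (w + h)"
      and "c = (u (x + 2 *\<^sub>R h + (w - h)) - u (x + 2 *\<^sub>R h)) \<bullet> (w - h)"
      and "e = (u (x + h + w) - u (x + h)) \<bullet> w"
    have "\<bar>second_diff u h x \<bullet> w\<bar> = \<bar>a / 2 + (- b) + (- c) + 2 * e\<bar>"
      unfolding second_diff_inner a_def b_def c_def e_def by simp
    then have "\<bar>second_diff u h x \<bullet> w\<bar> powr p
      \<le> 4 powr p * (\<bar>a / 2\<bar> powr p + \<bar>- b\<bar> powr p + \<bar>- c\<bar> powr p + \<bar>2 * e\<bar> powr p)"
      using sum4_powr_le[OF \<open>0 \<le> p\<close>] by metis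
    also have "\<dots> \<le> 4 powr p * (\<bar>2 * a\<bar> powr p + \<bar>2 * b\<bar> powr p + \<bar>2 * c\<bar> powr p + \<bar>2 * e\<bar> powr p)"
      using \<open>0 \<le> p\<close> by (intro mult_left_mono add_mono powr_mono2) auto
    also have "\<dots> = 4 powr p * 2 powr p * (\<bar>a\<bar> powr p + \<bar>b\<bar> powr p + \<bar>c\<bar> powr p + \<bar>e\<bar> powr p)"
      by (simp add: abs_mult powr_mult algebra_simps)
    also have "4 powr p * 2 powr p = (8::real) powr p" by (simp add: powr_mult[symmetric])
    finally have "ennreal (\<bar>second_diff u h x \<bullet> w\<bar> powr p)
      \<le> ennreal (8 powr p * (\<bar>a\<bar> powr p + \<bar>b\<bar> powr p + \<bar>c\<bar> powr p + \<bar>e\<bar> powr p))"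
      by (rule ennreal_leI)
    also have "\<dots> = ennreal (8 powr p) * (E (2 *\<^sub>R h) x + E (w + h) x + E (w - h) (x + 2 *\<^sub>R h) + E w (x + h))"
      unfolding E_def a_def b_def c_def e_def by (simp only: ennreal_mult' ennreal_plus powr_ge_zero add_nonneg_nonneg)
    finally show ?thesis .
  qed
  then have "(\<integral>\<^sup>+x. ennreal (\<bar>second_diff u h x \<bullet> w\<bar> powr p) \<partial>lborel)
    \<le> (\<integral>\<^sup>+x. ennreal (8 powr p) * (E (2 *\<^sub>R h) x + E (w + h) x + E (w - h) (x + 2 *\<^sub>R h) + E w (x + h)) \<partial>lborel)"
    by (rule nn_integral_mono)
  also have "\<dots> = ennreal (8 powr p) * ((\<integral>\<^sup>+x. E (2 *\<^sub>R h) x \<partial>lborel) + (\<integral>\<^sup>+x. E (w + h) x \<partial>lborel)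
      + (\<integral>\<^sup>+x. E (w - h) (x + 2 *\<^sub>R h) \<partial>lborel) + (\<integral>\<^sup>+x. E w (x + h) \<partial>lborel))"
    by (simp add: nn_integral_cmult nn_integral_add)
  also have "\<dots> = ennreal (8 powr p) * (strain p u (2 *\<^sub>R h) + strain p u (w + h) + strain p u (w - h) + strain p u w)"
    by (subst nn_integral_lborel_shift, measurable, subst nn_integral_lborel_shift, measurable)
       (simp add: E_def strain_def)
  finally show ?thesis .
qed

text \<open>If |w| < |h| and |t| is at most 1, then z = w + th has norm at most 2|h|. After
  translating the inner integral and exchanging the order, each z is weighted by the tail integral
  of |h|^(-k) over |h| at least |z|/2, which is a multiple of |z|^(d - k). At z = 0 the tail radius
  vanishes, and \<open>f 0 = 0\<close> makes both sides 0.\<close>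

lemma nn_integral_average_le:
  assumes "real DIM('a) < k"
  shows "\<exists>C\<ge>0. \<forall>(f::'a::euclidean_space \<Rightarrow> ennreal) t. f \<in> borel_measurable borel \<longrightarrow> f 0 = 0 \<longrightarrow> \<bar>t\<bar> \<le> 1 \<longrightarrow>
    (\<integral>\<^sup>+h. ennreal (norm h powr - k) * (\<integral>\<^sup>+w. (if norm w < norm h then f (w + t *\<^sub>R h) else 0) \<partial>lborel) \<partial>lborel)
      \<le> ennreal C * (\<integral>\<^sup>+z. f z * ennreal (norm z powr - (k - real DIM('a))) \<partial>lborel)"
proof -
  obtain C where "C \<ge> 0" and C: "\<And>r. r > 0 \<Longrightarrow>
      (\<integral>\<^sup>+h. ennreal (norm h powr - k) * indicator {h. r \<le> norm h} h \<partial>(lborel :: 'a measure))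
        \<le> ennreal (C * r powr (real DIM('a) - k))"
    using tail_integral[OF assms] by blast
  \<comment> \<open>The factor 2^(k - d) comes from the tail radius |z|/2.\<close>
  define C' where "C' = C * 2 powr (k - real DIM('a))"
  have "(\<integral>\<^sup>+h. ennreal (norm h powr - k) * (\<integral>\<^sup>+w. (if norm w < norm h then f (w + t *\<^sub>R h) else 0) \<partial>lborel) \<partial>lborel)
      \<le> ennreal C' * (\<integral>\<^sup>+z. f z * ennreal (norm z powr - (k - real DIM('a))) \<partial>lborel)"
    if [measurable]: "f \<in> borel_measurable borel" and "f 0 = 0" "\<bar>t\<bar> \<le> 1" for f :: "'a \<Rightarrow> ennreal" and t
  proof -
    have inner: "(\<integral>\<^sup>+w. (if norm w < norm h then f (w + t *\<^sub>R h) else 0) \<partial>lborel)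
      \<le> (\<integral>\<^sup>+z. (if norm z \<le> 2 * norm h then f z else 0) \<partial>lborel)" for h :: 'a
    proof -
      have *: "norm (w + t *\<^sub>R h) \<le> 2 * norm h" if "norm w < norm h" for w
      proof -
        have "\<bar>t\<bar> * norm h \<le> norm h" using \<open>\<bar>t\<bar> \<le> 1\<close> by (simp add: mult_left_le_one_le)
        then show ?thesis using norm_triangle_ineq[of w "t *\<^sub>R h"] that by simp
      qed
      have "(\<integral>\<^sup>+w. (if norm w < norm h then f (w + t *\<^sub>R h) else 0) \<partial>lborel)
        \<le> (\<integral>\<^sup>+w. (if norm (w + t *\<^sub>R h) \<le> 2 * norm h then f (w + t *\<^sub>R h) else 0) \<partial>lborel)"
        using * by (intro nn_integral_mono) auto
      also have "\<dots> = (\<integral>\<^sup>+z. (if norm z \<le> 2 * norm h then f z else 0) \<partial>lborel)"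
        by (rule nn_integral_lborel_shift[of "\<lambda>z. if norm z \<le> 2 * norm h then f z else 0"]) measurable
      finally show ?thesis .
    qed
    have "(\<integral>\<^sup>+h. ennreal (norm h powr - k) * (\<integral>\<^sup>+w. (if norm w < norm h then f (w + t *\<^sub>R h) else 0) \<partial>lborel) \<partial>lborel)
      \<le> (\<integral>\<^sup>+h. ennreal (norm h powr - k) * (\<integral>\<^sup>+z. (if norm z \<le> 2 * norm h then f z else 0) \<partial>lborel) \<partial>(lborel::'a measure))"
      by (rule nn_integral_mono, rule mult_left_mono[OF inner]) simp
    also have "\<dots> = (\<integral>\<^sup>+h. \<integral>\<^sup>+z. ennreal (norm h powr - k) * (if norm z \<le> 2 * norm h then f z else 0) \<partial>lborel \<partial>(lborel::'a measure))"
      by (simp add: nn_integral_cmult)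
    also have "\<dots> = (\<integral>\<^sup>+z. \<integral>\<^sup>+h. ennreal (norm h powr - k) * (if norm z \<le> 2 * norm h then f z else 0) \<partial>(lborel::'a measure) \<partial>lborel)"
      by (rule lborel_pair.Fubini') measurable
    also have "\<dots> \<le> (\<integral>\<^sup>+z. ennreal C' * (f z * ennreal (norm z powr - (k - real DIM('a)))) \<partial>lborel)"
    proof (rule nn_integral_mono)
      fix z :: 'a
      show "(\<integral>\<^sup>+h. ennreal (norm h powr - k) * (if norm z \<le> 2 * norm h then f z else 0) \<partial>(lborel::'a measure))
        \<le> ennreal C' * (f z * ennreal (norm z powr - (k - real DIM('a))))"
      proof (cases "z = 0")
        case True
        then show ?thesis using \<open>f 0 = 0\<close> by simp
      next
        case False
        have "(\<integral>\<^sup>+h. ennreal (norm h powr - k) * (if norm z \<le> 2 * norm h then f z else 0) \<partial>(lborel::'a measure))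
          = (\<integral>\<^sup>+h. f z * (ennreal (norm h powr - k) * indicator {h. norm z / 2 \<le> norm h} h) \<partial>(lborel::'a measure))"
          by (intro nn_integral_cong) (auto simp: indicator_def mult_ac)
        also have "\<dots> = f z * (\<integral>\<^sup>+h. (ennreal (norm h powr - k) * indicator {h. norm z / 2 \<le> norm h} h) \<partial>(lborel::'a measure))"
          by (rule nn_integral_cmult) measurable
        also have "\<dots> \<le> f z * ennreal (C * (norm z / 2) powr (real DIM('a) - k))"
          using False by (intro mult_left_mono C) auto
        also have "C * (norm z / 2) powr (real DIM('a) - k) = C' * norm z powr - (k - real DIM('a))"
          using powr_minus_divide[of 2 "k - real DIM('a)"] by (simp add: C'_def powr_divide)
        also have "f z * ennreal (C' * norm z powr - (k - real DIM('a)))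
          = ennreal C' * (f z * ennreal (norm z powr - (k - real DIM('a))))"
          using \<open>C \<ge> 0\<close> by (simp only: ennreal_mult' ennreal_mult'' powr_ge_zero mult_ac)
        finally show ?thesis .
      qed
    qed
    also have "\<dots> = ennreal C' * (\<integral>\<^sup>+z. f z * ennreal (norm z powr - (k - real DIM('a))) \<partial>lborel)"
      by (rule nn_integral_cmult) measurable
    finally show ?thesis .
  qed
  moreover have "C' \<ge> 0" using \<open>C \<ge> 0\<close> by (simp add: C'_def)
  ultimately show ?thesis by (intro exI[of _ C'] conjI allI impI)
qed

text \<open>For each x, \<open>average_lower_bound\<close> with v the second difference recovers its
  full norm from its products with w; Fubini then puts the integral over x inside.\<close>

lemma second_increment_average:
  assumes "0 \<le> p"
  shows "\<exists>c>0. \<forall>(u::'a::euclidean_space \<Rightarrow> 'a) h. u \<in> borel_measurable borel \<longrightarrow>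
    ennreal (c * norm h powr (real DIM('a) + p)) * second_increment p u h
      \<le> (\<integral>\<^sup>+w. (if norm w < norm h then \<integral>\<^sup>+x. ennreal (\<bar>second_diff u h x \<bullet> w\<bar> powr p) \<partial>lborel else 0) \<partial>lborel)"
proof -
  obtain c where "c > 0" and c: "\<And>(h::'a) (v::'a). ennreal (c * norm v powr p * norm h powr (real DIM('a) + p))
     \<le> (\<integral>\<^sup>+w. (if norm w < norm h then ennreal (\<bar>v \<bullet> w\<bar> powr p) else 0) \<partial>lborel)"
    using average_lower_bound[OF assms] by blast
  have "ennreal (c * norm h powr (real DIM('a) + p)) * second_increment p u h
      \<le> (\<integral>\<^sup>+w. (if norm w < norm h then \<integral>\<^sup>+x. ennreal (\<bar>second_diff u h x \<bullet> w\<bar> powr p) \<partial>lborel else 0) \<partial>lborel)"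
    if [measurable]: "u \<in> borel_measurable borel" for u :: "'a \<Rightarrow> 'a" and h
  proof -
    have [measurable]: "second_diff u h \<in> borel_measurable borel"
      unfolding second_diff_def[abs_def] by measurable
    have "ennreal (c * norm h powr (real DIM('a) + p)) * second_increment p u h
      = (\<integral>\<^sup>+x. ennreal (c * norm (second_diff u h x) powr p * norm h powr (real DIM('a) + p)) \<partial>lborel)"
      unfolding second_increment_def using \<open>c > 0\<close>
      by (subst nn_integral_cmult[symmetric]) (auto simp: ennreal_mult'[symmetric] mult_ac)
    also have "\<dots> \<le> (\<integral>\<^sup>+x. \<integral>\<^sup>+w. (if norm w < norm h then ennreal (\<bar>second_diff u h x \<bullet> w\<bar> powr p) else 0) \<partial>lborel \<partial>lborel)"
      by (intro nn_integral_mono c)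
    also have "\<dots> = (\<integral>\<^sup>+w. \<integral>\<^sup>+x. (if norm w < norm h then ennreal (\<bar>second_diff u h x \<bullet> w\<bar> powr p) else 0) \<partial>lborel \<partial>lborel)"
      by (rule lborel_pair.Fubini') measurable
    also have "\<dots> = (\<integral>\<^sup>+w. (if norm w < norm h then \<integral>\<^sup>+x. ennreal (\<bar>second_diff u h x \<bullet> w\<bar> powr p) \<partial>lborel else 0) \<partial>lborel)"
      by (intro nn_integral_cong) auto
    finally show ?thesis .
  qed
  with \<open>c > 0\<close> show ?thesis by (intro exI[of _ c] conjI allI impI)
qed

lemma second_increment_le_X_energy:
  assumes "0 < s" "0 < p"
  shows "\<exists>C\<ge>0. \<forall>u::'a::euclidean_space \<Rightarrow> 'a. u \<in> borel_measurable borel \<longrightarrow>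
    (\<integral>\<^sup>+h. second_increment p u h * ennreal (norm h powr - (real DIM('a) + s * p)) \<partial>lborel)
      \<le> ennreal C * X_energy s p UNIV u"
proof -
  \<comment> \<open>Here b is the exponent of the weight in \<open>X_energy_UNIV\<close>. Dividing
    by the factor |h|^(d + p) of \<open>second_increment_average\<close> turns the weight |h|^(-(d +
    sp)) into |h|^(-k), as k = (d + sp) + (d + p); the average over w later gives back d
    powers.\<close>
  define d b k V where "d = real DIM('a)" and "b = d + s * p + p" and "k = b + d" and "V = unit_ball_vol d"
  have "d > 0" by (simp add: d_def)
  have "V > 0" by (simp add: V_def d_def)
  have "d < k" using assms \<open>d > 0\<close> by (simp add: k_def b_def add_pos_pos)
  obtain c where "c > 0" and c: "\<And>(u::'a \<Rightarrow> 'a) h. u \<in> borel_measurable borel \<Longrightarrow>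
    ennreal (c * norm h powr (d + p)) * second_increment p u h
      \<le> (\<integral>\<^sup>+w. (if norm w < norm h then \<integral>\<^sup>+x. ennreal (\<bar>second_diff u h x \<bullet> w\<bar> powr p) \<partial>lborel else 0) \<partial>lborel)"
    using second_increment_average[where 'a='a, OF less_imp_le[OF \<open>0 < p\<close>]] unfolding d_def by blast
  obtain A where "A \<ge> 0" and A: "\<And>(f::'a \<Rightarrow> ennreal) t. f \<in> borel_measurable borel \<Longrightarrow> f 0 = 0 \<Longrightarrow> \<bar>t\<bar> \<le> 1 \<Longrightarrow>
    (\<integral>\<^sup>+h. ennreal (norm h powr - k) * (\<integral>\<^sup>+w. (if norm w < norm h then f (w + t *\<^sub>R h) else 0) \<partial>lborel) \<partial>lborel)
      \<le> ennreal A * (\<integral>\<^sup>+z. f z * ennreal (norm z powr - (k - d)) \<partial>lborel)"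
    using nn_integral_average_le[where 'a='a, OF \<open>d < k\<close>[unfolded d_def]] unfolding d_def by blast
  \<comment> \<open>The term with displacement 2h does not depend on w: its integral over w produces
    the volume V|h|^d, and rescaling h produces 2^(b - d).\<close>
  define B where "B = V * 2 powr (b - d)"
  have "B \<ge> 0" using \<open>V > 0\<close> by (simp add: B_def)
  \<comment> \<open>The factor 1/c undoes the lower bound for the average and 8^p is the four-term
    constant; B belongs to the displacement 2h, and one A to each of w + h, w - h and w.\<close>
  define C where "C = 1 / c * 8 powr p * (B + 3 * A)"
  have "(\<integral>\<^sup>+h. second_increment p u h * ennreal (norm h powr - (d + s * p)) \<partial>lborel)
      \<le> ennreal C * X_energy s p UNIV u" if u[measurable]: "u \<in> borel_measurable borel" for u :: "'a \<Rightarrow> 'a"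
  proof -
    define f where "f = strain p u"
    have f[measurable]: "f \<in> borel_measurable borel" and "f 0 = 0" by (simp_all add: f_def)
    have X: "X_energy s p UNIV u = (\<integral>\<^sup>+z. f z * ennreal (norm z powr - b) \<partial>lborel)"
      unfolding X_energy_UNIV[OF u] f_def b_def d_def ..
    \<comment> \<open>\<open>J g h\<close> is one weighted average over w. The displacements w + h,
      w - h and w are the cases t = 1, -1, 0 of \<open>J\<close> below; the displacement 2h is
      treated in \<open>J0\<close>.\<close>
    define J where "J = (\<lambda>(g::'a \<Rightarrow> 'a \<Rightarrow> ennreal) h. ennreal (norm h powr - k) * (\<integral>\<^sup>+w. (if norm w < norm h then g h w else 0) \<partial>(lborel::'a measure)))"
    have J: "(\<integral>\<^sup>+h. J (\<lambda>h w. f (w + t *\<^sub>R h)) h \<partial>lborel) \<le> ennreal A * X_energy s p UNIV u" if "\<bar>t\<bar> \<le> 1" for t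
      using A[OF f \<open>f 0 = 0\<close> that] by (simp add: J_def X k_def)
    have J0: "(\<integral>\<^sup>+h. J (\<lambda>h w. f (2 *\<^sub>R h)) h \<partial>lborel) = ennreal B * X_energy s p UNIV u"
    proof -
      have "J (\<lambda>h w. f (2 *\<^sub>R h)) h = ennreal V * (f (2 *\<^sub>R h) * ennreal (norm h powr - b))" for h
      proof (cases "h = 0")
        case False
        have "(\<integral>\<^sup>+w. (if norm w < norm h then f (2 *\<^sub>R h) else 0) \<partial>(lborel::'a measure))
          = (\<integral>\<^sup>+w. f (2 *\<^sub>R h) * indicator (ball 0 (norm h)) w \<partial>(lborel::'a measure))"
          by (intro nn_integral_cong) (auto simp: indicator_def)
        also have "\<dots> = f (2 *\<^sub>R h) * ennreal (V * norm h powr d)"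
          using False by (subst nn_integral_cmult_indicator) (auto simp: emeasure_ball V_def d_def powr_realpow)
        finally have "J (\<lambda>h w. f (2 *\<^sub>R h)) h = f (2 *\<^sub>R h) * ennreal (norm h powr - k * (V * norm h powr d))"
          unfolding J_def using \<open>V > 0\<close> by (simp add: ennreal_mult' mult.left_commute)
        also have "norm h powr - k * (V * norm h powr d) = V * norm h powr - b"
          by (simp add: k_def powr_add[symmetric])
        also have "f (2 *\<^sub>R h) * ennreal (V * norm h powr - b) = ennreal V * (f (2 *\<^sub>R h) * ennreal (norm h powr - b))"
          using \<open>V > 0\<close> by (simp add: ennreal_mult' mult.left_commute)
        finally show ?thesis .
      qed (simp add: J_def)
      then have "(\<integral>\<^sup>+h. J (\<lambda>h w. f (2 *\<^sub>R h)) h \<partial>lborel)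
          = ennreal V * (\<integral>\<^sup>+h. f (2 *\<^sub>R h) * ennreal (norm h powr - b) \<partial>lborel)"
        by (simp add: nn_integral_cmult)
      also have "\<dots> = ennreal V * (ennreal (2 powr (b - d)) * X_energy s p UNIV u)"
        unfolding X d_def by (subst nn_integral_scale_powr) auto
      finally show ?thesis
        by (simp add: B_def ennreal_mult'' mult.assoc)
    qed
    have "second_increment p u h * ennreal (norm h powr - (d + s * p))
      \<le> ennreal (1 / c * 8 powr p) * (J (\<lambda>h w. f (2 *\<^sub>R h)) h + J (\<lambda>h w. f (w + 1 *\<^sub>R h)) h
           + J (\<lambda>h w. f (w + (-1) *\<^sub>R h)) h + J (\<lambda>h w. f (w + 0 *\<^sub>R h)) h)" for h
    proof -
      define g where "g = (\<lambda>t w. if norm w < norm h then f (w + t *\<^sub>R h) else 0)"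
      define g0 where "g0 = (\<lambda>w::'a. if norm w < norm h then f (2 *\<^sub>R h) else 0)"
      have [measurable]: "g t \<in> borel_measurable borel" "g0 \<in> borel_measurable borel" for t
        unfolding g_def g0_def by measurable
      have g': "g t = (\<lambda>w. if norm w < norm h then f (w + t *\<^sub>R h) else 0)" for t
        by (simp add: g_def)
      have "norm h powr - (d + s * p) = 1 / c * norm h powr - k * (c * norm h powr (d + p))"
        using \<open>c > 0\<close> by (simp add: k_def b_def powr_add[symmetric])
      then have "second_increment p u h * ennreal (norm h powr - (d + s * p))
        = ennreal (1 / c) * (ennreal (norm h powr - k) * (ennreal (c * norm h powr (d + p)) * second_increment p u h))"
        using \<open>c > 0\<close> by (simp add: ennreal_mult'[symmetric] mult.assoc[symmetric] mult.commute[of "second_increment p u h"])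
      also have "\<dots> \<le> ennreal (1 / c) * (ennreal (norm h powr - k) * (\<integral>\<^sup>+w. (if norm w < norm h then
          \<integral>\<^sup>+x. ennreal (\<bar>second_diff u h x \<bullet> w\<bar> powr p) \<partial>lborel else 0) \<partial>lborel))"
        by (intro mult_left_mono c u) auto
      also have "\<dots> \<le> ennreal (1 / c) * (ennreal (norm h powr - k) *
          (\<integral>\<^sup>+w. ennreal (8 powr p) * (g0 w + g 1 w + g (- 1) w + g 0 w) \<partial>lborel))"
      proof (intro mult_left_mono nn_integral_mono)
        fix w
        show "(if norm w < norm h then \<integral>\<^sup>+x. ennreal (\<bar>second_diff u h x \<bullet> w\<bar> powr p) \<partial>lborel else 0)
          \<le> ennreal (8 powr p) * (g0 w + g 1 w + g (- 1) w + g 0 w)"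
          using nn_integral_second_diff_inner_le[OF u, of p h w] assms by (simp add: f_def g_def g0_def)
      qed auto
      also have "\<dots> = ennreal (1 / c) * (ennreal (8 powr p) * (J (\<lambda>h w. f (2 *\<^sub>R h)) h + J (\<lambda>h w. f (w + 1 *\<^sub>R h)) h
           + J (\<lambda>h w. f (w + (-1) *\<^sub>R h)) h + J (\<lambda>h w. f (w + 0 *\<^sub>R h)) h))"
        unfolding J_def g0_def[symmetric] g'[symmetric]
        by (simp add: nn_integral_cmult nn_integral_add) (simp only: distrib_left mult.left_commute)
      finally show ?thesis
        using \<open>c > 0\<close> by (simp only: ennreal_mult'' powr_ge_zero mult.assoc)
    qed
    then have "(\<integral>\<^sup>+h. second_increment p u h * ennreal (norm h powr - (d + s * p)) \<partial>lborel)
      \<le> (\<integral>\<^sup>+h. ennreal (1 / c * 8 powr p) * (J (\<lambda>h w. f (2 *\<^sub>R h)) h + J (\<lambda>h w. f (w + 1 *\<^sub>R h)) h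
           + J (\<lambda>h w. f (w + (-1) *\<^sub>R h)) h + J (\<lambda>h w. f (w + 0 *\<^sub>R h)) h) \<partial>lborel)"
      by (rule nn_integral_mono)
    also have "\<dots> = ennreal (1 / c * 8 powr p) * ((\<integral>\<^sup>+h. J (\<lambda>h w. f (2 *\<^sub>R h)) h \<partial>lborel) + (\<integral>\<^sup>+h. J (\<lambda>h w. f (w + 1 *\<^sub>R h)) h \<partial>lborel)
           + (\<integral>\<^sup>+h. J (\<lambda>h w. f (w + (-1) *\<^sub>R h)) h \<partial>lborel) + (\<integral>\<^sup>+h. J (\<lambda>h w. f (w + 0 *\<^sub>R h)) h \<partial>lborel))"
    proof -
      have [measurable]: "J (\<lambda>h w. f (2 *\<^sub>R h)) \<in> borel_measurable borel"
          "J (\<lambda>h w. f (w + t *\<^sub>R h)) \<in> borel_measurable borel" for t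
        unfolding J_def by measurable
      have "(\<integral>\<^sup>+h. a * (F h + G h + H h + K h) \<partial>lborel) = a * ((\<integral>\<^sup>+h. F h \<partial>lborel) + (\<integral>\<^sup>+h. G h \<partial>lborel)
          + (\<integral>\<^sup>+h. H h \<partial>lborel) + (\<integral>\<^sup>+h. K h \<partial>lborel))"
        if [measurable]: "F \<in> borel_measurable borel" "G \<in> borel_measurable borel"
          "H \<in> borel_measurable borel" "K \<in> borel_measurable borel" for a and F G H K :: "'a \<Rightarrow> ennreal"
        by (simp add: nn_integral_cmult nn_integral_add)
      then show ?thesis by measurable
    qed
    also have "\<dots> \<le> ennreal (1 / c * 8 powr p) * (ennreal B * X_energy s p UNIV u + ennreal A * X_energy s p UNIV u
        + ennreal A * X_energy s p UNIV u + ennreal A * X_energy s p UNIV u)"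
      by (intro mult_left_mono add_mono J) (simp_all add: J0)
    also have "\<dots> = ennreal (1 / c * 8 powr p) * (ennreal (B + 3 * A) * X_energy s p UNIV u)"
    proof -
      have "B + 3 * A = B + A + A + A" by simp
      then have "ennreal (B + 3 * A) = ennreal B + ennreal A + ennreal A + ennreal A"
        using \<open>A \<ge> 0\<close> \<open>B \<ge> 0\<close> by (simp only: ennreal_plus add_nonneg_nonneg)
      then show ?thesis by (simp only: distrib_right)
    qed
    also have "\<dots> = ennreal C * X_energy s p UNIV u"
    proof -
      have "ennreal C = ennreal (1 / c * 8 powr p) * ennreal (B + 3 * A)"
        unfolding C_def using \<open>c > 0\<close> by (intro ennreal_mult') simp
      then show ?thesis by (simp only: mult.assoc)
    qed
    finally show ?thesis .
  qed
  moreover have "C \<ge> 0" using \<open>c > 0\<close> \<open>A \<ge> 0\<close> \<open>B \<ge> 0\<close> by (simp add: C_def)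
  ultimately show ?thesis unfolding d_def by (intro exI[of _ C] conjI allI impI)
qed

section \<open>Absorption: first differences controlled by second differences\<close>

text \<open>Finiteness of x permits subtracting q x from both sides in the reals and dividing by 1 -
  q > 0. This is why the \<open>W\<close>-energy has to be truncated before it is absorbed.\<close>

lemma ennreal_absorb:
  fixes x y :: ennreal and q :: real
  assumes "x \<le> ennreal q * x + y" "x < top" "0 \<le> q" "q < 1"
  shows "x \<le> ennreal (1 / (1 - q)) * y"
proof (cases "y = top")
  case True
  then show ?thesis using \<open>q < 1\<close> by (simp add: ennreal_mult_top)
next
  case False
  obtain a where a: "x = ennreal a" "0 \<le> a" using \<open>x < top\<close> by (cases x) auto
  obtain b where b: "y = ennreal b" "0 \<le> b" using False by (cases y) auto
  have "ennreal a \<le> ennreal (q * a + b)"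
    using assms(1) a b \<open>0 \<le> q\<close> by (simp add: ennreal_mult')
  then have "a \<le> q * a + b" using a b \<open>0 \<le> q\<close> by (simp add: ennreal_le_iff del: ennreal_plus)
  then have "a \<le> 1 / (1 - q) * b" using \<open>q < 1\<close> by (simp add: field_simps)
  then have "ennreal a \<le> ennreal (1 / (1 - q) * b)" by (rule ennreal_leI)
  also have "\<dots> = ennreal (1 / (1 - q)) * ennreal b" using b by (intro ennreal_mult'')
  finally show ?thesis using a b by simp
qed

text \<open>Twice the difference over h is the difference over 2h minus the second difference.
  Splitting the power with \<open>add_powr_le\<close> keeps the coefficient of the doubled increment
  near 2^(-p) when e is small.\<close>

lemma increment_le_double:
  fixes u :: "'a::euclidean_space \<Rightarrow> 'a"
  assumes [measurable]: "u \<in> borel_measurable borel" and "0 \<le> p" "0 < e"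
  shows "increment p u h \<le> ennreal (((1 + e) / 2) powr p) * increment p u (2 *\<^sub>R h)
    + ennreal (((1 + 1 / e) / 2) powr p) * second_increment p u h"
proof -
  have [measurable]: "second_diff u h \<in> borel_measurable borel"
    unfolding second_diff_def[abs_def] by measurable
  have "ennreal (norm (u (x + h) - u x) powr p)
    \<le> ennreal (((1 + e) / 2) powr p) * ennreal (norm (u (x + 2 *\<^sub>R h) - u x) powr p)
      + ennreal (((1 + 1 / e) / 2) powr p) * ennreal (norm (second_diff u h x) powr p)" for x
  proof -
    define a b where "a = norm (u (x + 2 *\<^sub>R h) - u x)" and "b = norm (second_diff u h x)"
    have ab: "0 \<le> a" "0 \<le> b" by (simp_all add: a_def b_def)
    have "2 *\<^sub>R (u (x + h) - u x) = (u (x + 2 *\<^sub>R h) - u x) - second_diff u h x"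
      by (simp add: second_diff_def scaleR_diff_right scaleR_2)
    then have "2 * norm (u (x + h) - u x) \<le> a + b"
      unfolding a_def b_def using norm_triangle_ineq4 by (metis abs_numeral norm_scaleR)
    then have "norm (u (x + h) - u x) \<le> a / 2 + b / 2" by simp
    then have "norm (u (x + h) - u x) powr p \<le> (a / 2 + b / 2) powr p"
      using \<open>0 \<le> p\<close> by (intro powr_mono2) auto
    also have "\<dots> \<le> (1 + e) powr p * (a / 2) powr p + (1 + 1 / e) powr p * (b / 2) powr p"
      using ab assms by (intro add_powr_le) auto
    also have "\<dots> = ((1 + e) / 2) powr p * a powr p + ((1 + 1 / e) / 2) powr p * b powr p"
      using ab \<open>0 < e\<close> by (simp add: powr_divide)
    finally have "ennreal (norm (u (x + h) - u x) powr p)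
      \<le> ennreal (((1 + e) / 2) powr p * a powr p + ((1 + 1 / e) / 2) powr p * b powr p)"
      by (rule ennreal_leI)
    then show ?thesis by (simp add: a_def b_def ennreal_mult')
  qed
  then have "increment p u h \<le> (\<integral>\<^sup>+x. ennreal (((1 + e) / 2) powr p) * ennreal (norm (u (x + 2 *\<^sub>R h) - u x) powr p)
      + ennreal (((1 + 1 / e) / 2) powr p) * ennreal (norm (second_diff u h x) powr p) \<partial>lborel)"
    unfolding increment_def by (rule nn_integral_mono)
  also have "\<dots> = ennreal (((1 + e) / 2) powr p) * increment p u (2 *\<^sub>R h)
    + ennreal (((1 + 1 / e) / 2) powr p) * second_increment p u h"
    unfolding increment_def second_increment_def by (simp add: nn_integral_cmult nn_integral_add)
  finally show ?thesis .
qed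

text \<open>This bound is uniform in h; it serves only to show that the truncated energy is
  finite.\<close>

lemma increment_le_norm:
  fixes u :: "'a::euclidean_space \<Rightarrow> 'a"
  assumes [measurable]: "u \<in> borel_measurable borel" and "0 \<le> p"
  shows "increment p u h \<le> ennreal (2 powr p * 2) * (\<integral>\<^sup>+x. ennreal (norm (u x) powr p) \<partial>lborel)"
proof -
  have "ennreal (norm (u (x + h) - u x) powr p)
    \<le> ennreal (2 powr p) * (ennreal (norm (u (x + h)) powr p) + ennreal (norm (u x) powr p))" for x
  proof -
    have "norm (u (x + h) - u x) powr p \<le> (norm (u (x + h)) + norm (u x)) powr p"
      using \<open>0 \<le> p\<close> by (intro powr_mono2 norm_triangle_ineq4) auto
    also have "\<dots> \<le> 2 powr p * (norm (u (x + h)) powr p + norm (u x) powr p)"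
      using add_powr_le[of "norm (u (x + h))" "norm (u x)" 1 p] \<open>0 \<le> p\<close> by (simp add: distrib_left)
    finally have "ennreal (norm (u (x + h) - u x) powr p)
        \<le> ennreal (2 powr p * (norm (u (x + h)) powr p + norm (u x) powr p))"
      by (rule ennreal_leI)
    then show ?thesis by (simp add: ennreal_mult')
  qed
  then have "increment p u h
    \<le> (\<integral>\<^sup>+x. ennreal (2 powr p) * (ennreal (norm (u (x + h)) powr p) + ennreal (norm (u x) powr p)) \<partial>lborel)"
    unfolding increment_def by (rule nn_integral_mono)
  also have "\<dots> = ennreal (2 powr p) * ((\<integral>\<^sup>+x. ennreal (norm (u (x + h)) powr p) \<partial>lborel) + (\<integral>\<^sup>+x. ennreal (norm (u x) powr p) \<partial>lborel))"
    by (simp add: nn_integral_cmult nn_integral_add)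
  also have "(\<integral>\<^sup>+x. ennreal (norm (u (x + h)) powr p) \<partial>lborel) = (\<integral>\<^sup>+x. ennreal (norm (u x) powr p) \<partial>lborel)"
    by (rule nn_integral_lborel_shift[of "\<lambda>x. ennreal (norm (u x) powr p)"]) measurable
  also have "ennreal (2 powr p) * ((\<integral>\<^sup>+x. ennreal (norm (u x) powr p) \<partial>lborel) + (\<integral>\<^sup>+x. ennreal (norm (u x) powr p) \<partial>lborel))
    = ennreal (2 powr p * 2) * (\<integral>\<^sup>+x. ennreal (norm (u x) powr p) \<partial>lborel)"
    by (simp add: ennreal_mult' mult_2[symmetric] mult.assoc)
  finally show ?thesis .
qed

text \<open>Doubling h maps the region |h| at least r into itself, so the truncated energy bounds
  its own rescaled copy and can be absorbed. The resulting constant does not depend on r or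
  u.\<close>

lemma truncated_W_energy_le:
  assumes "0 < s" "s < 1" "0 < p"
  shows "\<exists>C\<ge>0. \<forall>(u::'a::euclidean_space \<Rightarrow> 'a) r. u \<in> borel_measurable borel \<longrightarrow>
    (\<integral>\<^sup>+x. ennreal (norm (u x) powr p) \<partial>lborel) < top \<longrightarrow> 0 < r \<longrightarrow>
    (\<integral>\<^sup>+h. increment p u h * ennreal (norm h powr - (real DIM('a) + s * p)) * indicator {h. r \<le> norm h} h \<partial>lborel)
      \<le> ennreal C * (\<integral>\<^sup>+h. second_increment p u h * ennreal (norm h powr - (real DIM('a) + s * p)) \<partial>lborel)"
proof -
  \<comment> \<open>With e = 0 the contraction factor would be 2^(-(1 - s)p). The choice 1 + e =
    2^((1 - s)/2) gives up half of this exponent and leaves q = 2^(-(1 - s)p/2) < 1.\<close>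
  define e where "e = 2 powr ((1 - s) / 2) - 1"
  define q where "q = ((1 + e) / 2) powr p * 2 powr (s * p)"
  define B where "B = ((1 + 1 / e) / 2) powr p"
  define g where "g = real DIM('a) + s * p"
  have "1 < 2 powr ((1 - s) / 2)" using assms by simp
  then have "0 < e" by (simp add: e_def)
  have "(1 + e) / 2 = 2 powr ((1 - s) / 2 - 1)" by (simp add: e_def powr_diff)
  then have "q = 2 powr (((1 - s) / 2 - 1) * p + s * p)"
    by (simp add: q_def powr_powr powr_add)
  also have "((1 - s) / 2 - 1) * p + s * p = - ((1 - s) / 2 * p)" by (simp add: field_simps)
  finally have q: "q = 2 powr - ((1 - s) / 2 * p)" .
  have "0 \<le> q" by (simp add: q_def)
  have "0 < (1 - s) / 2 * p" using assms by simp
  then have "q < 1" unfolding q by (intro powr_less_one) auto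
  have "B \<ge> 0" by (simp add: B_def)
  have bound: "(\<integral>\<^sup>+h. increment p u h * ennreal (norm h powr - g) * indicator {h. r \<le> norm h} h \<partial>lborel)
      \<le> ennreal (1 / (1 - q) * B) * (\<integral>\<^sup>+h. second_increment p u h * ennreal (norm h powr - g) \<partial>lborel)"
      (is "?W \<le> _ * ?R")
    if u[measurable]: "u \<in> borel_measurable borel" and fin: "(\<integral>\<^sup>+x. ennreal (norm (u x) powr p) \<partial>lborel) < top"
      and "0 < r" for u :: "'a \<Rightarrow> 'a" and r
  proof -
    let ?N = "\<integral>\<^sup>+x. ennreal (norm (u x) powr p) \<partial>lborel"
    \<comment> \<open>Finiteness comes first: a bound on the increment uniform in h, times a weight
      integrable away from the origin.\<close>
    have "?W \<le> (\<integral>\<^sup>+h. ennreal (2 powr p * 2) * ?N * (ennreal (norm h powr - g) * indicator {h. r \<le> norm h} h) \<partial>(lborel::'a measure))"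
    proof (rule nn_integral_mono)
      fix h :: 'a
      show "increment p u h * ennreal (norm h powr - g) * indicator {h. r \<le> norm h} h
        \<le> ennreal (2 powr p * 2) * ?N * (ennreal (norm h powr - g) * indicator {h. r \<le> norm h} h)"
        unfolding mult.assoc[of "increment p u h"] using assms
        by (intro mult_right_mono increment_le_norm) auto
    qed
    also have "\<dots> = ennreal (2 powr p * 2) * ?N * (\<integral>\<^sup>+h. ennreal (norm h powr - g) * indicator {h. r \<le> norm h} h \<partial>(lborel::'a measure))"
      by (rule nn_integral_cmult) measurable
    also have "\<dots> < top"
    proof -
      have "real DIM('a) < g" using assms by (simp add: g_def)
      from tail_integral[OF this] obtain C where
        "(\<integral>\<^sup>+h. ennreal (norm h powr - g) * indicator {h. r \<le> norm h} h \<partial>(lborel::'a measure)) \<le> ennreal C"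
        using \<open>0 < r\<close> by blast
      then have "(\<integral>\<^sup>+h. ennreal (norm h powr - g) * indicator {h. r \<le> norm h} h \<partial>(lborel::'a measure)) < top"
        by (rule le_less_trans) simp
      then show ?thesis using fin by (simp add: ennreal_mult_less_top)
    qed
    finally have "?W < top" .
    \<comment> \<open>The cutoff is at 2r because 2h has norm at least 2r exactly when h has norm at
      least r.\<close>
    define f where "f = (\<lambda>h. increment p u h * indicator {h. 2 * r \<le> norm h} h)"
    have f[measurable]: "f \<in> borel_measurable borel" unfolding f_def by measurable
    have "?W \<le> (\<integral>\<^sup>+h. ennreal (((1 + e) / 2) powr p) * (f (2 *\<^sub>R h) * ennreal (norm h powr - g))
          + ennreal B * (second_increment p u h * ennreal (norm h powr - g)) \<partial>lborel)"
    proof (rule nn_integral_mono)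
      fix h
      show "increment p u h * ennreal (norm h powr - g) * indicator {h. r \<le> norm h} h
        \<le> ennreal (((1 + e) / 2) powr p) * (f (2 *\<^sub>R h) * ennreal (norm h powr - g))
          + ennreal B * (second_increment p u h * ennreal (norm h powr - g))"
      proof (cases "r \<le> norm h")
        case True
        have "increment p u h * ennreal (norm h powr - g)
          \<le> (ennreal (((1 + e) / 2) powr p) * increment p u (2 *\<^sub>R h) + ennreal B * second_increment p u h) * ennreal (norm h powr - g)"
          unfolding B_def using assms \<open>0 < e\<close> by (intro mult_right_mono increment_le_double) auto
        then show ?thesis using True by (simp add: f_def distrib_right mult.assoc)
      qed simp
    qed
    also have "\<dots> = ennreal (((1 + e) / 2) powr p) * (\<integral>\<^sup>+h. f (2 *\<^sub>R h) * ennreal (norm h powr - g) \<partial>lborel) + ennreal B * ?R"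
    proof -
      have "(\<integral>\<^sup>+h. a * F h + b * G h \<partial>lborel) = a * (\<integral>\<^sup>+h. F h \<partial>lborel) + b * (\<integral>\<^sup>+h. G h \<partial>lborel)"
        if [measurable]: "F \<in> borel_measurable borel" "G \<in> borel_measurable borel"
        for a b and F G :: "'a \<Rightarrow> ennreal"
        by (simp add: nn_integral_cmult nn_integral_add)
      then show ?thesis by measurable
    qed
    also have "(\<integral>\<^sup>+h. f (2 *\<^sub>R h) * ennreal (norm h powr - g) \<partial>lborel)
        = ennreal (2 powr (s * p)) * (\<integral>\<^sup>+h. f h * ennreal (norm h powr - g) \<partial>lborel)"
      unfolding nn_integral_scale_powr[OF f] by (simp add: g_def)
    also have "ennreal (((1 + e) / 2) powr p) * (ennreal (2 powr (s * p)) * (\<integral>\<^sup>+h. f h * ennreal (norm h powr - g) \<partial>lborel))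
      = ennreal q * (\<integral>\<^sup>+h. f h * ennreal (norm h powr - g) \<partial>lborel)"
      by (simp add: q_def ennreal_mult' mult.assoc)
    \<comment> \<open>Relaxing the cutoff from 2r to r recovers the quantity being
      estimated.\<close>
    also have "\<dots> \<le> ennreal q * ?W"
      using \<open>0 < r\<close> by (intro mult_left_mono nn_integral_mono) (auto simp: f_def indicator_def)
    finally have "?W \<le> ennreal q * ?W + ennreal B * ?R"
      by (simp add: add_right_mono)
    from ennreal_absorb[OF this \<open>?W < top\<close> \<open>0 \<le> q\<close> \<open>q < 1\<close>]
    show ?thesis
      unfolding ennreal_mult''[OF \<open>B \<ge> 0\<close>] mult.assoc[of "ennreal (1 / (1 - q))"] .
  qed
  have "1 / (1 - q) * B \<ge> 0" using \<open>q < 1\<close> \<open>B \<ge> 0\<close> by simp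
  with bound show ?thesis unfolding g_def by (intro exI[of _ "1 / (1 - q) * B"] conjI allI impI)
qed

text \<open>The truncated bound is uniform in r, so monotone convergence along r = 1/(n + 1) removes
  the truncation.\<close>

lemma W_energy_le_second_increment:
  assumes "0 < s" "s < 1" "0 < p"
  shows "\<exists>C\<ge>0. \<forall>u::'a::euclidean_space \<Rightarrow> 'a. u \<in> borel_measurable borel \<longrightarrow>
    (\<integral>\<^sup>+x. ennreal (norm (u x) powr p) \<partial>lborel) < top \<longrightarrow>
    W_energy s p UNIV u
      \<le> ennreal C * (\<integral>\<^sup>+h. second_increment p u h * ennreal (norm h powr - (real DIM('a) + s * p)) \<partial>lborel)"
proof -
  obtain C where "C \<ge> 0" and C: "\<And>(u::'a \<Rightarrow> 'a) r. u \<in> borel_measurable borel \<Longrightarrow>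
    (\<integral>\<^sup>+x. ennreal (norm (u x) powr p) \<partial>lborel) < top \<Longrightarrow> 0 < r \<Longrightarrow>
    (\<integral>\<^sup>+h. increment p u h * ennreal (norm h powr - (real DIM('a) + s * p)) * indicator {h. r \<le> norm h} h \<partial>lborel)
      \<le> ennreal C * (\<integral>\<^sup>+h. second_increment p u h * ennreal (norm h powr - (real DIM('a) + s * p)) \<partial>lborel)"
    using truncated_W_energy_le[where 'a='a, OF assms] by blast
  have "W_energy s p UNIV u
      \<le> ennreal C * (\<integral>\<^sup>+h. second_increment p u h * ennreal (norm h powr - (real DIM('a) + s * p)) \<partial>lborel)"
    if u[measurable]: "u \<in> borel_measurable borel" and fin: "(\<integral>\<^sup>+x. ennreal (norm (u x) powr p) \<partial>lborel) < top" for u :: "'a \<Rightarrow> 'a"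
  proof -
    define F where "F = (\<lambda>h. increment p u h * ennreal (norm h powr - (real DIM('a) + s * p)))"
    define G where "G = (\<lambda>(n::nat) h. F h * indicator {h. 1 / real (Suc n) \<le> norm h} h)"
    have [measurable]: "F \<in> borel_measurable borel" unfolding F_def by measurable
    have [measurable]: "G n \<in> borel_measurable borel" for n unfolding G_def by measurable
    have "incseq G"
    proof (intro incseq_SucI le_funI)
      fix n h
      have "1 / real (Suc (Suc n)) \<le> 1 / real (Suc n)" by (simp add: frac_le)
      then show "G n h \<le> G (Suc n) h"
        unfolding G_def indicator_def by (auto intro: order_trans)
    qed
    \<comment> \<open>No truncation reaches h = 0, but \<open>F 0 = 0\<close> because the weight
      there is a power of 0.\<close>
    have "F h \<le> (SUP n. G n h)" for h
    proof (cases "h = 0")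
      case False
      then obtain n where "1 / real (Suc n) < norm h"
        using nat_approx_posE[of "norm h"] by auto
      then have "F h = G n h" by (simp add: G_def)
      then show ?thesis by (metis SUP_upper UNIV_I)
    qed (simp add: F_def)
    then have "W_energy s p UNIV u \<le> (\<integral>\<^sup>+h. (SUP n. G n h) \<partial>lborel)"
      unfolding W_energy_UNIV[OF u] F_def[symmetric] by (intro nn_integral_mono) (auto simp: F_def)
    also have "\<dots> = (SUP n. \<integral>\<^sup>+h. G n h \<partial>lborel)"
      using \<open>incseq G\<close> by (rule nn_integral_monotone_convergence_SUP) measurable
    also have "\<dots> \<le> ennreal C * (\<integral>\<^sup>+h. second_increment p u h * ennreal (norm h powr - (real DIM('a) + s * p)) \<partial>lborel)"
      unfolding G_def F_def by (intro SUP_least C u fin) simp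
    finally show ?thesis .
  qed
  with \<open>C \<ge> 0\<close> show ?thesis by (intro exI[of _ C] conjI allI impI)
qed

theorem korn_UNIV:
  assumes "0 < s" "s < 1" "0 < p"
  shows "\<exists>C\<ge>0. \<forall>u::'a::euclidean_space \<Rightarrow> 'a. u \<in> borel_measurable borel \<longrightarrow>
    (\<integral>\<^sup>+x. ennreal (norm (u x) powr p) \<partial>lborel) < top \<longrightarrow>
    W_energy s p UNIV u \<le> ennreal C * X_energy s p UNIV u"
proof -
  obtain A where "A \<ge> 0" and A: "\<And>u::'a \<Rightarrow> 'a. u \<in> borel_measurable borel \<Longrightarrow>
    (\<integral>\<^sup>+x. ennreal (norm (u x) powr p) \<partial>lborel) < top \<Longrightarrow> W_energy s p UNIV u
      \<le> ennreal A * (\<integral>\<^sup>+h. second_increment p u h * ennreal (norm h powr - (real DIM('a) + s * p)) \<partial>lborel)"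
    using W_energy_le_second_increment[where 'a='a, OF assms] by blast
  obtain B where "B \<ge> 0" and B: "\<And>u::'a \<Rightarrow> 'a. u \<in> borel_measurable borel \<Longrightarrow>
    (\<integral>\<^sup>+h. second_increment p u h * ennreal (norm h powr - (real DIM('a) + s * p)) \<partial>lborel)
      \<le> ennreal B * X_energy s p UNIV u"
    using second_increment_le_X_energy[where 'a='a, OF assms(1,3)] by blast
  have "W_energy s p UNIV u \<le> ennreal (A * B) * X_energy s p UNIV u"
    if u: "u \<in> borel_measurable borel" and fin: "(\<integral>\<^sup>+x. ennreal (norm (u x) powr p) \<partial>lborel) < top" for u :: "'a \<Rightarrow> 'a"
    using order_trans[OF A[OF u fin] mult_left_mono[OF B[OF u]]] \<open>A \<ge> 0\<close> by (simp add: ennreal_mult' mult.assoc)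
  moreover have "A * B \<ge> 0" using \<open>A \<ge> 0\<close> \<open>B \<ge> 0\<close> by simp
  ultimately show ?thesis by (intro exI[of _ "A * B"] conjI allI impI)
qed

section \<open>Domains: extension by zero and the Hardy integral\<close>

text \<open>These are the two requirements of \<open>korn_UNIV\<close>. Continuity of u on the open
  set gives measurability; on the compact support u is bounded, and that support has finite
  measure.\<close>

lemma Cc1_extend_by_zero:
  assumes "u \<in> Cc1 D" "open D" "0 \<le> p"
  defines "v \<equiv> \<lambda>x. if x \<in> D then u x else 0"
  shows "v \<in> borel_measurable borel" and "(\<integral>\<^sup>+x. ennreal (norm (v x) powr p) \<partial>lborel) < top"
proof -
  let ?K = "closure {x \<in> D. u x \<noteq> 0}"
  have K: "compact ?K" "?K \<subseteq> D" using assms(1) by (auto simp: Cc1_def)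
  have cont: "continuous_on D u"
    using assms(1) unfolding Cc1_def
    by (auto intro!: continuous_at_imp_continuous_on dest!: has_derivative_continuous bspec)
  show "v \<in> borel_measurable borel"
    unfolding v_def using \<open>open D\<close> cont by (intro borel_measurable_continuous_on_if) auto
  have "bounded (u ` ?K)"
    using K cont by (intro compact_imp_bounded compact_continuous_image) (auto intro: continuous_on_subset)
  then obtain M where M: "\<And>x. x \<in> ?K \<Longrightarrow> norm (u x) \<le> M" unfolding bounded_iff by auto
  have "ennreal (norm (v x) powr p) \<le> ennreal (M powr p) * indicator ?K x" for x
  proof (cases "v x = 0")
    case False
    then have x: "x \<in> D" "u x \<noteq> 0" unfolding v_def by (auto split: if_splits)
    then have "x \<in> ?K" using closure_subset[of "{x \<in> D. u x \<noteq> 0}"] by auto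
    moreover have "norm (v x) powr p \<le> M powr p"
      using M[OF \<open>x \<in> ?K\<close>] x \<open>0 \<le> p\<close> unfolding v_def by (intro powr_mono2) auto
    ultimately show ?thesis by (simp add: ennreal_leI)
  qed simp
  then have "(\<integral>\<^sup>+x. ennreal (norm (v x) powr p) \<partial>lborel) \<le> (\<integral>\<^sup>+x. ennreal (M powr p) * indicator ?K x \<partial>lborel)"
    by (rule nn_integral_mono)
  also have "\<dots> = ennreal (M powr p) * emeasure lborel ?K"
    by (rule nn_integral_cmult_indicator) simp
  also have "\<dots> < top"
    using emeasure_bounded_finite[OF compact_imp_bounded[OF K(1)]] by (simp add: ennreal_mult_less_top)
  finally show "(\<integral>\<^sup>+x. ennreal (norm (v x) powr p) \<partial>lborel) < top" .
qed

lemma W_energy_le_extend: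
  fixes D :: "'a::euclidean_space set"
  shows "W_energy s p D u \<le> W_energy s p UNIV (\<lambda>x. if x \<in> D then u x else 0)"
  unfolding W_energy_def
proof (rule nn_integral_mono)
  fix y :: 'a
  let ?v = "\<lambda>x. if x \<in> D then u x else 0"
  let ?g = "\<lambda>u x. ennreal (norm (u x - u y) powr p / norm (x - y) powr (real DIM('a) + s * p))"
  have "(\<integral>\<^sup>+x\<in>D. ?g u x \<partial>lborel) \<le> (\<integral>\<^sup>+x\<in>UNIV. ?g ?v x \<partial>lborel)" if "y \<in> D"
    using that by (intro nn_integral_mono) (auto simp: indicator_def)
  then show "(\<integral>\<^sup>+x\<in>D. ?g u x \<partial>lborel) * indicator D y \<le> (\<integral>\<^sup>+x\<in>UNIV. ?g ?v x \<partial>lborel) * indicator UNIV y"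
    by (cases "y \<in> D") simp_all
qed

text \<open>Pairs of points inside \<open>D\<close> give the energy of u, and pairs outside give 0.
  For y in \<open>D\<close> and x outside, the projected difference is at most |u(y)|, while |x - y|
  is at least the distance r of y to the complement; the tail integral over x is then a multiple of
  r^(-sp), which is the Hardy weight. Mixed pairs occur in both orders, hence the factor 2.\<close>

lemma X_energy_extend_le:
  assumes "0 < s" "0 < p"
  shows "\<exists>C\<ge>0. \<forall>D (u::'a::euclidean_space \<Rightarrow> 'a). open D \<longrightarrow>
    (\<lambda>x. if x \<in> D then u x else 0) \<in> borel_measurable borel \<longrightarrow>
    X_energy s p UNIV (\<lambda>x. if x \<in> D then u x else 0) \<le> X_energy s p D u + ennreal C * Hardy_integral s p D u"
proof -
  define g where "g = real DIM('a) + s * p"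
  have g: "real DIM('a) < g" using assms by (simp add: g_def)
  obtain C where "C \<ge> 0" and C: "\<And>r. r > 0 \<Longrightarrow>
      (\<integral>\<^sup>+h. ennreal (norm h powr - g) * indicator {h. r \<le> norm h} h \<partial>(lborel :: 'a measure))
        \<le> ennreal (C * r powr (real DIM('a) - g))"
    using tail_integral[OF g] by blast
  have "X_energy s p UNIV (\<lambda>x. if x \<in> D then u x else 0) \<le> X_energy s p D u + ennreal (2 * C) * Hardy_integral s p D u"
    if "open D" and vm: "(\<lambda>x. if x \<in> D then u x else 0) \<in> borel_measurable borel" for D and u :: "'a \<Rightarrow> 'a"
  \<comment> \<open>For \<open>D = UNIV\<close> the extension is u itself and the Hardy integral is
    0.\<close>
  proof (cases "D = UNIV")
    case False
    define v where "v = (\<lambda>x. if x \<in> D then u x else 0)"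
    have v[measurable]: "v \<in> borel_measurable borel" using vm by (simp add: v_def)
    have [measurable]: "D \<in> sets borel" using \<open>open D\<close> by simp
    define G where "G = (\<lambda>(u::'a \<Rightarrow> 'a) x y.
      ennreal (\<bar>(u x - u y) \<bullet> ((x - y) /\<^sub>R norm (x - y))\<bar> powr p / norm (x - y) powr g))"
    \<comment> \<open>\<open>H x y\<close> majorises the mixed pairs with y in \<open>D\<close> and
      x outside; \<open>H y x\<close> covers the opposite order.\<close>
    define H where "H = (\<lambda>x y. ennreal (norm (v y) powr p) * indicator D y *
      (ennreal (norm (x - y) powr - g) * indicator (- D) x))"
    have [measurable]: "case_prod (G v) \<in> borel_measurable (borel \<Otimes>\<^sub>M borel)"
      "case_prod H \<in> borel_measurable (borel \<Otimes>\<^sub>M borel)"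
      unfolding G_def H_def by measurable
    have *: "ennreal (\<bar>w \<bullet> (z /\<^sub>R norm z)\<bar> powr p / norm z powr g)
      \<le> ennreal (norm w powr p) * ennreal (norm z powr - g)" for w z :: 'a
    proof -
      have "\<bar>w \<bullet> (z /\<^sub>R norm z)\<bar> \<le> norm w * norm (z /\<^sub>R norm z)" by (rule Cauchy_Schwarz_ineq2)
      also have "\<dots> \<le> norm w" by (cases "z = 0") simp_all
      finally have "\<bar>w \<bullet> (z /\<^sub>R norm z)\<bar> powr p \<le> norm w powr p" using assms by (intro powr_mono2) auto
      then have "\<bar>w \<bullet> (z /\<^sub>R norm z)\<bar> powr p / norm z powr g \<le> norm w powr p * norm z powr - g"
        by (simp add: powr_minus divide_inverse mult_right_mono)
      then show ?thesis by (subst ennreal_mult'[symmetric]) (simp_all only: powr_ge_zero ennreal_leI)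
    qed
    have "G v x y \<le> G v x y * indicator D x * indicator D y + H x y + H y x" for x y
      using *[of "v x" "x - y"] *[of "v y" "y - x"] *[of "- v y" "x - y"]
      by (cases "x \<in> D"; cases "y \<in> D") (simp_all add: G_def H_def v_def norm_minus_commute)
    then have "(\<integral>\<^sup>+y. \<integral>\<^sup>+x. G v x y \<partial>lborel \<partial>lborel)
      \<le> (\<integral>\<^sup>+y. \<integral>\<^sup>+x. G v x y * indicator D x * indicator D y + H x y + H y x \<partial>lborel \<partial>lborel)"
      by (intro nn_integral_mono)
    also have "\<dots> = (\<integral>\<^sup>+y. \<integral>\<^sup>+x. G v x y * indicator D x * indicator D y \<partial>lborel \<partial>lborel)
        + (\<integral>\<^sup>+y. \<integral>\<^sup>+x. H x y \<partial>lborel \<partial>lborel) + (\<integral>\<^sup>+y. \<integral>\<^sup>+x. H y x \<partial>lborel \<partial>lborel)"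
      by (simp add: nn_integral_add)
    also have "(\<integral>\<^sup>+y. \<integral>\<^sup>+x. H y x \<partial>lborel \<partial>lborel) = (\<integral>\<^sup>+y. \<integral>\<^sup>+x. H x y \<partial>lborel \<partial>lborel)"
      by (rule lborel_pair.Fubini') measurable
    also have "(\<integral>\<^sup>+y. \<integral>\<^sup>+x. G v x y * indicator D x * indicator D y \<partial>lborel \<partial>lborel) = X_energy s p D u"
      unfolding X_energy_def g_def[symmetric]
    proof (rule nn_integral_cong)
      fix y
      show "(\<integral>\<^sup>+x. G v x y * indicator D x * indicator D y \<partial>lborel)
        = (\<integral>\<^sup>+x\<in>D. ennreal (\<bar>(u x - u y) \<bullet> ((x - y) /\<^sub>R norm (x - y))\<bar> powr p / norm (x - y) powr g) \<partial>lborel) * indicator D y"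
      proof (cases "y \<in> D")
        case True
        then show ?thesis
          by (simp, intro nn_integral_cong) (simp add: G_def v_def indicator_def)
      qed simp
    qed
    finally have X: "X_energy s p UNIV v \<le> X_energy s p D u
        + (\<integral>\<^sup>+y. \<integral>\<^sup>+x. H x y \<partial>lborel \<partial>lborel) + (\<integral>\<^sup>+y. \<integral>\<^sup>+x. H x y \<partial>lborel \<partial>lborel)"
      by (simp add: X_energy_def G_def g_def)
    have "(\<integral>\<^sup>+y. \<integral>\<^sup>+x. H x y \<partial>lborel \<partial>lborel)
      \<le> (\<integral>\<^sup>+y. ennreal C * (ennreal (norm (u y) powr p / infdist y (- D) powr (s * p)) * indicator D y) \<partial>lborel)"
    proof (rule nn_integral_mono)
      fix y
      show "(\<integral>\<^sup>+x. H x y \<partial>lborel)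
        \<le> ennreal C * (ennreal (norm (u y) powr p / infdist y (- D) powr (s * p)) * indicator D y)"
      proof (cases "y \<in> D")
        case True
        define r where "r = infdist y (- D)"
        \<comment> \<open>The complement is closed and, in this case, nonempty, so its distance to a
          point of \<open>D\<close> is positive.\<close>
        have "r > 0" unfolding r_def
          using True False \<open>open D\<close> by (intro infdist_pos_not_in_closed) auto
        have "(\<integral>\<^sup>+x. ennreal (norm (x - y) powr - g) * indicator (- D) x \<partial>lborel)
          \<le> (\<integral>\<^sup>+x. ennreal (norm (x - y) powr - g) * indicator {h. r \<le> norm h} (x - y) \<partial>lborel)"
        proof (intro nn_integral_mono mult_left_mono)
          fix x
          show "indicator (- D) x \<le> (indicator {h. r \<le> norm h} (x - y) :: ennreal)"
            using infdist_le[of x "- D" y] by (auto simp: indicator_def r_def dist_norm norm_minus_commute)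
        qed simp
        also have "\<dots> = (\<integral>\<^sup>+h. ennreal (norm h powr - g) * indicator {h. r \<le> norm h} h \<partial>(lborel::'a measure))"
          using nn_integral_lborel_shift[of "\<lambda>h::'a. ennreal (norm h powr - g) * indicator {h. r \<le> norm h} h" "- y"] by simp
        also have "\<dots> \<le> ennreal (C * r powr (real DIM('a) - g))"
          using \<open>r > 0\<close> by (rule C)
        finally have tail: "(\<integral>\<^sup>+x. ennreal (norm (x - y) powr - g) * indicator (- D) x \<partial>lborel) \<le> ennreal (C * r powr - (s * p))"
          by (simp add: g_def)
        have "(\<integral>\<^sup>+x. H x y \<partial>lborel)
          = ennreal (norm (v y) powr p) * indicator D y * (\<integral>\<^sup>+x. ennreal (norm (x - y) powr - g) * indicator (- D) x \<partial>lborel)"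
          unfolding H_def by (rule nn_integral_cmult) measurable
        also have "\<dots> \<le> ennreal (norm (v y) powr p) * indicator D y * ennreal (C * r powr - (s * p))"
          by (rule mult_left_mono[OF tail]) simp
        also have "\<dots> = ennreal C * (ennreal (norm (u y) powr p / r powr (s * p)) * indicator D y)"
          using True \<open>C \<ge> 0\<close> by (simp add: v_def powr_minus divide_inverse ennreal_mult' mult.left_commute)
        finally show ?thesis unfolding r_def .
      qed (simp add: H_def)
    qed
    also have "\<dots> = ennreal C * Hardy_integral s p D u"
    proof -
      have [measurable]: "(\<lambda>y. infdist y (- D)) \<in> borel_measurable borel"
        by (intro borel_measurable_continuous_onI continuous_on_infdist continuous_on_id)
      \<comment> \<open>Outside \<open>D\<close> the values of u are arbitrary, so measurability is
        transferred from v, which agrees with u on \<open>D\<close>.\<close>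
      have "(\<lambda>y. ennreal (norm (u y) powr p / infdist y (- D) powr (s * p)) * indicator D y)
        = (\<lambda>y. ennreal (norm (v y) powr p / infdist y (- D) powr (s * p)) * indicator D y)"
        by (intro ext) (simp add: v_def indicator_def)
      then have [measurable]: "(\<lambda>y. ennreal (norm (u y) powr p / infdist y (- D) powr (s * p)) * indicator D y)
          \<in> borel_measurable borel"
        by simp
      show ?thesis using False by (simp add: Hardy_integral_def nn_integral_cmult)
    qed
    finally have H: "(\<integral>\<^sup>+y. \<integral>\<^sup>+x. H x y \<partial>lborel \<partial>lborel) \<le> ennreal C * Hardy_integral s p D u" .
    have "X_energy s p UNIV v \<le> X_energy s p D u + ennreal C * Hardy_integral s p D u + ennreal C * Hardy_integral s p D u"
      by (rule order_trans[OF X]) (intro add_mono H order_refl)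
    also have "\<dots> = X_energy s p D u + ennreal (2 * C) * Hardy_integral s p D u"
    proof -
      have "ennreal (2 * C) = ennreal C + ennreal C"
        using \<open>C \<ge> 0\<close> by (simp flip: ennreal_plus)
      then show ?thesis by (simp only: distrib_right add.assoc)
    qed
    finally show ?thesis unfolding v_def .
  qed simp
  with \<open>C \<ge> 0\<close> show ?thesis by (intro exI[of _ "2 * C"] conjI allI impI) auto
qed

section \<open>Seminorms and the final estimate\<close>

text \<open>The maximum with 1 supplies the constant at least 1 asked for in the theorem; being
  nonzero, it also keeps the right side infinite when y is.\<close>

lemma ennroot_le:
  assumes "x \<le> ennreal K * y" "0 \<le> K" "0 < p"
  shows "ennroot p x \<le> ennreal (max 1 (K powr (1 / p))) * ennroot p y"
proof (cases "y = top")
  case True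
  then show ?thesis by (simp add: ennroot_def ennreal_mult_top)
next
  case False
  obtain b where b: "y = ennreal b" "0 \<le> b" using False by (cases y) auto
  have le: "x \<le> ennreal (K * b)" using assms b by (simp add: ennreal_mult')
  then obtain a where a: "x = ennreal a" "0 \<le> a" by (cases x) (auto simp: top_unique)
  have "a \<le> K * b" using le a b assms by simp
  then have "a powr (1 / p) \<le> (K * b) powr (1 / p)" using a assms by (intro powr_mono2) auto
  also have "\<dots> = K powr (1 / p) * b powr (1 / p)" using b assms by (simp add: powr_mult)
  also have "\<dots> \<le> max 1 (K powr (1 / p)) * b powr (1 / p)" by (intro mult_right_mono) auto
  finally have "ennreal (a powr (1 / p)) \<le> ennreal (max 1 (K powr (1 / p)) * b powr (1 / p))"
    by (rule ennreal_leI)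
  then show ?thesis using a b by (simp add: ennroot_def ennreal_mult'')
qed

theorem proposition4p1:
  fixes D :: "(real ^ 'd) set" and s p :: real
  assumes "CARD('d) > 1"
    and "1 < p" and "0 < s" and "s < 1"
    and "open D"
    and "\<exists>C\<^sub>H::real. C\<^sub>H \<ge> 0 \<and>
           (\<forall>u\<in>Cc1 D. Hardy_integral s p D u \<le> ennreal C\<^sub>H * X_energy s p D u)"
  shows "\<exists>C::real. C \<ge> 1 \<and>
           (\<forall>u\<in>Cc1 D. ennreal C * X_seminorm s p D u \<ge> W_seminorm s p D u)"
proof -
  have "0 < p" using \<open>1 < p\<close> by simp
  obtain A where "A \<ge> 0" and A: "\<And>u. u \<in> Cc1 D \<Longrightarrow> Hardy_integral s p D u \<le> ennreal A * X_energy s p D u"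
    using assms(6) by blast
  obtain B where "B \<ge> 0" and B: "\<And>u::real^'d \<Rightarrow> real^'d. u \<in> borel_measurable borel \<Longrightarrow>
    (\<integral>\<^sup>+x. ennreal (norm (u x) powr p) \<partial>lborel) < top \<Longrightarrow> W_energy s p UNIV u \<le> ennreal B * X_energy s p UNIV u"
    using korn_UNIV[where 'a="real^'d", OF \<open>0 < s\<close> \<open>s < 1\<close> \<open>0 < p\<close>] by blast
  obtain E where "E \<ge> 0" and E: "\<And>u::real^'d \<Rightarrow> real^'d. (\<lambda>x. if x \<in> D then u x else 0) \<in> borel_measurable borel \<Longrightarrow>
    X_energy s p UNIV (\<lambda>x. if x \<in> D then u x else 0) \<le> X_energy s p D u + ennreal E * Hardy_integral s p D u"
    using X_energy_extend_le[where 'a="real^'d", OF \<open>0 < s\<close> \<open>0 < p\<close>] \<open>open D\<close> by blast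
  \<comment> \<open>B is Korn's constant on the whole space. The energy of the extension is at most
    that of u plus E times the Hardy integral, and the hypothesis bounds the latter by A times the
    energy of u.\<close>
  define K where "K = B * (1 + E * A)"
  have "K \<ge> 0" using \<open>A \<ge> 0\<close> \<open>B \<ge> 0\<close> \<open>E \<ge> 0\<close> by (simp add: K_def)
  have K: "W_energy s p D u \<le> ennreal K * X_energy s p D u" if u: "u \<in> Cc1 D" for u
  proof -
    let ?v = "\<lambda>x. if x \<in> D then u x else 0"
    note v = Cc1_extend_by_zero[OF u \<open>open D\<close> less_imp_le[OF \<open>0 < p\<close>]]
    have "W_energy s p D u \<le> ennreal B * X_energy s p UNIV ?v"
      by (rule order_trans[OF W_energy_le_extend B[OF v]])
    also have "\<dots> \<le> ennreal B * (X_energy s p D u + ennreal E * (ennreal A * X_energy s p D u))"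
      by (intro mult_left_mono order_trans[OF E[OF v(1)]] add_left_mono A u) simp_all
    also have "\<dots> = ennreal K * X_energy s p D u"
    proof -
      have "ennreal K = ennreal B * (1 + ennreal E * ennreal A)"
        using \<open>A \<ge> 0\<close> \<open>B \<ge> 0\<close> \<open>E \<ge> 0\<close> by (simp add: K_def ennreal_mult')
      then show ?thesis by (simp only: distrib_right mult_1_left mult.assoc)
    qed
    finally show ?thesis .
  qed
  show ?thesis unfolding W_seminorm_def X_seminorm_def
    by (intro exI[of _ "max 1 (K powr (1 / p))"] conjI ballI ennroot_le K \<open>K \<ge> 0\<close> \<open>0 < p\<close>) simp_all
qed

end
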